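(* Let $0<\eta_-<\eta_+\le2$, $g:=\eta_+-\eta_-$, $\beta\in(0,1)$, $\delta\in(0,1)$, and let the set cover solver have approximation factor $\alpha\ge1$. Set $$\Lambda:=K\log2+\log\left(\frac{2mA_0}{\beta}\right),\qquad n:=\left\lceil\frac{16\Lambda}{g^2}\right\rceil,$$ draw $n$ calibration samples from $Q_i^a$ for every $(i,a)\in[M]\times\mathcal A_0$, and form the empirical cover sets $\widehat{\mathcal C}_u$, $u\in\mathcal U$. With probability at least $1-\beta$ over the calibration samples, $$\mathcal C_u(\eta_+)\subseteq\widehat{\mathcal C}_u\subseteq\mathcal C_u(\eta_-)\qquad\text{for every }u\in\mathcal U.$$ On the same event: 1. every design $S\subseteq\mathcal U$ that covers the empirical pair sets, i.e. $\bigcup_{u\in S}\widehat{\mathcal C}_u=\mathcal J$, is $\eta_-$-separating; 2. if an $\eta_+$-separating design exists, the solver, run on the empirical cover instance, returns a design $\widehat S$ satisfying $C(\widehat S)\le\alpha\, C(S_{\eta_+}^\star)$, where $S_{\eta_+}^\star$ is a minimum-cost $\eta_+$-separating design; 3. if the empirical cover instance is infeasible (no $S\subseteq\mathcal U$ has $\bigcup_{u\in S}\widehat{\mathcal C}_u=\mathcal J$), then no $\eta_+$-separating design exists; 4. every returned empirical cover $\widehat S$ satisfies $$V_\delta(\gamma_{\widehat S};b_0)\le (M-1)\left\lceil\frac{8}{\eta_-^2}\log\frac{M-1}{\delta}\right\rceil .$$ The calibration stage uses exactly $nMA_0$ samples.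
   Context: Fix an integer $M\ge 2$ and write $[M]=\{1,\dots,M\}$. All logarithms are natural. Model. $(\mathcal A,\mathscr A)$ is a measurable space of evaluations and $(\mathsf Y,\mathcal Y)$ a measurable response space. For each $i\in[M]$, $P_i$ is a Markov kernel from $(\mathcal A,\mathscr A)$ to $(\mathsf Y,\mathcal Y)$, and $P_i^a(B):=P_i(a,B)$. The prior $b_0$ is a probability vector on $[M]$ with $b_0(i)>0$ for all $i$; the unknown index $I^\star$ is drawn from $b_0$. At each time $t\ge1$ the evaluator picks $A_t\in\mathcal A$ from the history $H_{t-1}=((A_1,Y_1),\dots,(A_{t-1},Y_{t-1}))$ ($H_0=\varnothing$) and then observes $Y_t$; $\mathcal F_t:=\sigma(H_t)$. A policy $\pi=(\pi_t)_{t\ge1}$ is a sequence of probability kernels with $\mathbb P(A_t\in C\mid\mathcal F_{t-1})=\pi_t(C\mid H_{t-1})$ a.s. for all $C\in\mathscr A$. Responses satisfy $\mathbb P(Y_t\in B\mid I^\star=i,\mathcal F_{t-1},A_t)=P_i^{A_t}(B)$ a.s. for all $i\in[M]$, $B\in\mathcal Y$. $\mathbb P_{b_0}^\pi,\mathbb E_{b_0}^\pi$ denote probability and expectation under the induced law. For $a\in\mathcal A$ let $\mu^a:=\sum_{i=1}^M P_i^a$; it is assumed that the densities $p_i^a(y)=\frac{dP_i^a}{d\mu^a}(y)$ have versions jointly measurable in $(a,y)$. Modules and designs. $\mathcal U$ is a finite nonempty collection of probe modules; each $u\in\mathcal U$ has a cost $\kappa_u>0$ and a nonempty finite (measurable)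 set of evaluations $\mathcal A_u\subseteq\mathcal A$. A design is a subset $S\subseteq\mathcal U$; $C(S):=\sum_{u\in S}\kappa_u$, $\mathcal A_S:=\bigcup_{u\in S}\mathcal A_u$, and $\gamma_S$ denotes the design with available action set $\mathcal A_S$. Let $\mathcal A_0:=\bigcup_{u\in\mathcal U}\mathcal A_u$ and $A_0:=|\mathcal A_0|$. Inner value. For $\delta\in(0,1)$, an admissible procedure under $\gamma_S$ consists of a policy $\pi$ supported on $\mathcal A_S$ (all actions lie in $\mathcal A_S$), an almost surely finite stopping time $\tau$ (with respect to $(\mathcal F_t)$), and an $\mathcal F_\tau$-measurable estimate $\widehat I\in[M]$. Define $V_\delta(\gamma_S;b_0):=\inf_{\pi,\tau,\widehat I}\mathbb E_{b_0}^\pi[\tau]$ subject to $\mathbb P_{b_0}^\pi(\widehat I\ne I^\star)\le\delta$, with the infimum over an empty feasible set equal to $+\infty$. Summaries and separation. $K\ge1$ is an integer, and for each evaluation $a$ there is a fixed measurable summary $\varphi_a:\mathsf Y\to[K]$. $Q_i^a$ denotes the law on $[K]$ of $\varphi_a(Y)$ when $Y\sim P_i^a$. Let $\mathcal J:=\{(i,j):1\le i<j\le M\}$ and $m:=|\mathcal J|=\binom M2$. For $u\in\mathcal U$ and $(i,j)\in\mathcal J$, $d_{ij}(u):=\max_{a\in\mathcal A_u}\|Q_i^a-Q_j^a\|_1$. For a design $S$, $\Delta(S):=\min_{(i,j)\in\mathcal J}\max_{u\in S}d_{ij}(u)$ (maximum over the empty set $=0$); $S$ is $\eta$-separating if $\Delta(S)\ge\eta$.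 For $\eta\in(0,2]$, $\mathcal C_u(\eta):=\{(i,j)\in\mathcal J:d_{ij}(u)\ge\eta\}$. Calibration. All calibration samples are independent (across candidates, evaluations and draws): for each $(i,a)\in[M]\times\mathcal A_0$, $n$ i.i.d. samples are drawn from $Q_i^a$, and they are separate from the later interaction with the unknown model. $\widehat Q_i^a$ is the empirical law of the $n$ samples for $(i,a)$; the same samples are reused for all pairs and modules. Define $\widehat d_{ij}(u):=\max_{a\in\mathcal A_u}\|\widehat Q_i^a-\widehat Q_j^a\|_1$ and $$\widehat{\mathcal C}_u:=\left\{(i,j)\in\mathcal J:\widehat d_{ij}(u)\ge\frac{\eta_-+\eta_+}{2}\right\}.$$ Solver. The empirical cover instance is: minimize $C(S)$ over $S\subseteq\mathcal U$ subject to $\bigcup_{u\in S}\widehat{\mathcal C}_u=\mathcal J$. A cover solver with approximation factor $\alpha\ge1$ is a procedure which, on any feasible weighted set cover instance, returns a feasible cover of cost at most $\alpha$ times the optimal cost. A "returned empirical cover" is a design $\widehat S$ returned by the solver, which in particular satisfies $\bigcup_{u\in\widehat S}\widehat{\mathcal C}_u=\mathcal J$. *)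

theory Defs
  imports "HOL-Probability.Probability"
begin

section \<open>Sequential interaction and the inner value\<close>

text \<open>Candidates are the indices in \<open>{1..M}\<close>.  \<open>A\<close> and \<open>Y\<close> are the measurable spaces of evaluations
  and of responses (only their carriers and sigma-algebras are used).  Rounds are numbered from 0 in
  the code: the pair \<open>(A\<^sub>t, Y\<^sub>t)\<close> of the usual numbering \<open>t \<ge> 1\<close> is coordinate \<open>t - 1\<close> of a trajectory, so
  that the history before coordinate \<open>t\<close> is a point of the product space over \<open>{0..<t}\<close>.\<close>

definition candidate_sum :: "nat \<Rightarrow> 'y measure \<Rightarrow> (nat \<Rightarrow> 'a \<Rightarrow> 'y measure) \<Rightarrow> 'a \<Rightarrow> 'y measure" where
  "candidate_sum M Y P a =
     measure_of (space Y) (sets Y) (\<lambda>B. \<Sum>i\<in>{1..M}. emeasure (P i a) B)"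

definition jointly_measurable_densities ::
    "nat \<Rightarrow> 'a measure \<Rightarrow> 'y measure \<Rightarrow> (nat \<Rightarrow> 'a \<Rightarrow> 'y measure) \<Rightarrow> bool" where
  "jointly_measurable_densities M A Y P \<longleftrightarrow>
     (\<exists>p :: nat \<Rightarrow> 'a \<Rightarrow> 'y \<Rightarrow> ennreal. \<forall>i\<in>{1..M}.
        (\<lambda>(a, y). p i a y) \<in> borel_measurable (A \<Otimes>\<^sub>M Y) \<and>
        (\<forall>a\<in>space A. P i a = density (candidate_sum M Y P a) (p i a)))"

definition policy ::
    "'a measure \<Rightarrow> 'y measure \<Rightarrow> (nat \<Rightarrow> (nat \<Rightarrow> 'a \<times> 'y) \<Rightarrow> 'a measure) \<Rightarrow> bool" where
  "policy A Y \<pi> \<longleftrightarrow>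
     (\<forall>t. \<pi> t \<in> (\<Pi>\<^sub>M s\<in>{0..<t}. A \<Otimes>\<^sub>M Y) \<rightarrow>\<^sub>M prob_algebra A)"

definition supported_policy ::
    "'a measure \<Rightarrow> 'y measure \<Rightarrow> 'a set \<Rightarrow> (nat \<Rightarrow> (nat \<Rightarrow> 'a \<times> 'y) \<Rightarrow> 'a measure) \<Rightarrow> bool" where
  "supported_policy A Y B \<pi> \<longleftrightarrow> policy A Y \<pi> \<and>
     (\<forall>t. \<forall>h \<in> space (\<Pi>\<^sub>M s\<in>{0..<t}. A \<Otimes>\<^sub>M Y). AE a in \<pi> t h. a \<in> B)"

text \<open>One round when the responses come from the kernel \<open>R\<close>: the conditional law of the
  evaluation-response pair given the history \<open>h\<close>.\<close>

definition round_kernel ::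
    "'a measure \<Rightarrow> 'y measure \<Rightarrow> ('a \<Rightarrow> 'y measure) \<Rightarrow> (nat \<Rightarrow> (nat \<Rightarrow> 'a \<times> 'y) \<Rightarrow> 'a measure) \<Rightarrow>
     nat \<Rightarrow> (nat \<Rightarrow> 'a \<times> 'y) \<Rightarrow> ('a \<times> 'y) measure" where
  "round_kernel A Y R \<pi> t h =
     \<pi> t h \<bind> (\<lambda>a. R a \<bind> (\<lambda>y. return (A \<Otimes>\<^sub>M Y) (a, y)))"

text \<open>The law of the infinite trajectory: the projective limit built from the round kernels by the
  Ionescu-Tulcea theorem (the lemma \<open>Ionescu_Tulcea_round_kernel\<close> below shows that the theorem
  applies).\<close>

definition trajectory_law ::
    "'a measure \<Rightarrow> 'y measure \<Rightarrow> ('a \<Rightarrow> 'y measure) \<Rightarrow> (nat \<Rightarrow> (nat \<Rightarrow> 'a \<times> 'y) \<Rightarrow> 'a measure) \<Rightarrow>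
     (nat \<Rightarrow> 'a \<times> 'y) measure" where
  "trajectory_law A Y R \<pi> =
     projective_family.lim UNIV
       (Ionescu_Tulcea.CI (round_kernel A Y R \<pi>) (\<lambda>_. A \<Otimes>\<^sub>M Y)) (\<lambda>_. A \<Otimes>\<^sub>M Y)"

definition run_space :: "nat \<Rightarrow> 'a measure \<Rightarrow> 'y measure \<Rightarrow> (nat \<times> (nat \<Rightarrow> 'a \<times> 'y)) measure" where
  "run_space M A Y = count_space {1..M} \<Otimes>\<^sub>M (\<Pi>\<^sub>M t\<in>UNIV. A \<Otimes>\<^sub>M Y)"

text \<open>The law of (unknown index, trajectory): the index has law \<open>b\<close> and, given the index \<open>i\<close>, the
  trajectory is generated by the policy and the response kernel \<open>P i\<close>.\<close>

definition run_law ::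
    "nat \<Rightarrow> (nat \<Rightarrow> real) \<Rightarrow> 'a measure \<Rightarrow> 'y measure \<Rightarrow> (nat \<Rightarrow> 'a \<Rightarrow> 'y measure) \<Rightarrow>
     (nat \<Rightarrow> (nat \<Rightarrow> 'a \<times> 'y) \<Rightarrow> 'a measure) \<Rightarrow> (nat \<times> (nat \<Rightarrow> 'a \<times> 'y)) measure" where
  "run_law M b A Y P \<pi> =
     point_measure {1..M} (\<lambda>i. ennreal (b i)) \<bind>
       (\<lambda>i. distr (trajectory_law A Y (P i) \<pi>) (run_space M A Y) (\<lambda>\<omega>. (i, \<omega>)))"

text \<open>The sigma-algebra generated by the first \<open>T\<close> rounds.  The time index is \<^typ>\<open>enat\<close>, so that
  stopping times may take the value \<open>\<infinity>\<close>; at \<open>T = \<infinity>\<close> this is the sigma-algebra generated by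
  the whole trajectory.  The unknown index is not observed.\<close>

definition history_filtration ::
    "nat \<Rightarrow> 'a measure \<Rightarrow> 'y measure \<Rightarrow> enat \<Rightarrow> (nat \<times> (nat \<Rightarrow> 'a \<times> 'y)) measure" where
  "history_filtration M A Y T =
     vimage_algebra (space (run_space M A Y))
       (\<lambda>(i, \<omega>). restrict \<omega> {s. enat s < T}) (\<Pi>\<^sub>M s\<in>{s. enat s < T}. A \<Otimes>\<^sub>M Y)"

definition admissible_procedure ::
    "nat \<Rightarrow> (nat \<Rightarrow> real) \<Rightarrow> 'a measure \<Rightarrow> 'y measure \<Rightarrow> (nat \<Rightarrow> 'a \<Rightarrow> 'y measure) \<Rightarrow> 'a set \<Rightarrow>
     (nat \<Rightarrow> (nat \<Rightarrow> 'a \<times> 'y) \<Rightarrow> 'a measure) \<Rightarrow>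
     (nat \<times> (nat \<Rightarrow> 'a \<times> 'y) \<Rightarrow> enat) \<Rightarrow> (nat \<times> (nat \<Rightarrow> 'a \<times> 'y) \<Rightarrow> nat) \<Rightarrow> bool" where
  "admissible_procedure M b A Y P B \<pi> \<tau> Ihat \<longleftrightarrow>
     supported_policy A Y B \<pi> \<and>
     stopping_time (history_filtration M A Y) \<tau> \<and>
     (AE x in run_law M b A Y P \<pi>. \<tau> x < \<infinity>) \<and>
     Ihat \<in> filtration.pre_sigma (space (run_space M A Y)) (history_filtration M A Y) \<tau>
              \<rightarrow>\<^sub>M count_space {1..M}"

definition error_probability ::
    "nat \<Rightarrow> (nat \<Rightarrow> real) \<Rightarrow> 'a measure \<Rightarrow> 'y measure \<Rightarrow> (nat \<Rightarrow> 'a \<Rightarrow> 'y measure) \<Rightarrow>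
     (nat \<Rightarrow> (nat \<Rightarrow> 'a \<times> 'y) \<Rightarrow> 'a measure) \<Rightarrow> (nat \<times> (nat \<Rightarrow> 'a \<times> 'y) \<Rightarrow> nat) \<Rightarrow> real" where
  "error_probability M b A Y P \<pi> Ihat =
     measure (run_law M b A Y P \<pi>) {x \<in> space (run_space M A Y). Ihat x \<noteq> fst x}"

text \<open>The infimum is taken in \<^typ>\<open>ennreal\<close>, so it is \<open>\<infinity>\<close> if there is no feasible procedure.
  \<open>B\<close> is the available action set.\<close>

definition inner_value ::
    "real \<Rightarrow> nat \<Rightarrow> (nat \<Rightarrow> real) \<Rightarrow> 'a measure \<Rightarrow> 'y measure \<Rightarrow> (nat \<Rightarrow> 'a \<Rightarrow> 'y measure) \<Rightarrow>
     'a set \<Rightarrow> ennreal" where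
  "inner_value \<delta> M b A Y P B =
     (INF (\<pi>, \<tau>, Ihat) \<in> {(\<pi>, \<tau>, Ihat). admissible_procedure M b A Y P B \<pi> \<tau> Ihat \<and>
                                      error_probability M b A Y P \<pi> Ihat \<le> \<delta>}.
        \<integral>\<^sup>+ x. ennreal_of_enat (\<tau> x) \<partial>run_law M b A Y P \<pi>)"


section \<open>Summaries, separation and cover sets\<close>

definition pairs :: "nat \<Rightarrow> (nat \<times> nat) set" where
  "pairs M = {(i, j). 1 \<le> i \<and> i < j \<and> j \<le> M}"

definition summary_law ::
    "nat \<Rightarrow> (nat \<Rightarrow> 'a \<Rightarrow> 'y measure) \<Rightarrow> ('a \<Rightarrow> 'y \<Rightarrow> nat) \<Rightarrow> nat \<Rightarrow> 'a \<Rightarrow> nat measure" where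
  "summary_law K P \<phi> i a = distr (P i a) (count_space {1..K}) (\<phi> a)"

text \<open>The empirical law of \<open>x 0, \<dots>, x (n - 1)\<close> on \<open>{1..K}\<close>: the law of \<open>x l\<close> for a uniformly random
  sample number \<open>l\<close>.\<close>

definition empirical_law :: "nat \<Rightarrow> nat \<Rightarrow> (nat \<Rightarrow> nat) \<Rightarrow> nat measure" where
  "empirical_law K n x = distr (uniform_count_measure {..<n}) (count_space {1..K}) x"

definition l1_dist :: "nat \<Rightarrow> nat measure \<Rightarrow> nat measure \<Rightarrow> real" where
  "l1_dist K \<mu> \<nu> = (\<Sum>k\<in>{1..K}. \<bar>measure \<mu> {k} - measure \<nu> {k}\<bar>)"

text \<open>In the following definitions \<open>Q\<close> is a family of laws on \<open>{1..K}\<close>, either the true summary laws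
  or the empirical ones, and \<open>\<A> u\<close> is the set of evaluations of the module \<open>u\<close>.\<close>

definition module_sep ::
    "nat \<Rightarrow> (nat \<Rightarrow> 'a \<Rightarrow> nat measure) \<Rightarrow> ('u \<Rightarrow> 'a set) \<Rightarrow> 'u \<Rightarrow> nat \<times> nat \<Rightarrow> real" where
  "module_sep K Q \<A> u = (\<lambda>(i, j). Max ((\<lambda>a. l1_dist K (Q i a) (Q j a)) ` \<A> u))"

definition design_sep ::
    "nat \<Rightarrow> nat \<Rightarrow> (nat \<Rightarrow> 'a \<Rightarrow> nat measure) \<Rightarrow> ('u \<Rightarrow> 'a set) \<Rightarrow> 'u set \<Rightarrow> real" where
  "design_sep M K Q \<A> S =
     Min ((\<lambda>ij. if S = {} then 0 else Max ((\<lambda>u. module_sep K Q \<A> u ij) ` S)) ` pairs M)"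

definition separating ::
    "nat \<Rightarrow> nat \<Rightarrow> (nat \<Rightarrow> 'a \<Rightarrow> nat measure) \<Rightarrow> ('u \<Rightarrow> 'a set) \<Rightarrow> real \<Rightarrow> 'u set \<Rightarrow> bool" where
  "separating M K Q \<A> \<eta> S \<longleftrightarrow> \<eta> \<le> design_sep M K Q \<A> S"

definition cover_sets ::
    "nat \<Rightarrow> nat \<Rightarrow> (nat \<Rightarrow> 'a \<Rightarrow> nat measure) \<Rightarrow> ('u \<Rightarrow> 'a set) \<Rightarrow> real \<Rightarrow> 'u \<Rightarrow> (nat \<times> nat) set" where
  "cover_sets M K Q \<A> \<eta> u = {ij \<in> pairs M. \<eta> \<le> module_sep K Q \<A> u ij}"


section \<open>Weighted set cover\<close>

text \<open>An instance consists of a finite index set \<open>U\<close>, sets \<open>C u\<close> and positive weights \<open>w u\<close> for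
  \<open>u \<in> U\<close>, and a finite ground set \<open>X\<close>.  A solver maps instances to subfamilies; nothing is required
  of it on infeasible instances.\<close>

type_synonym ('u, 'e) solver =
  "'u set \<Rightarrow> ('u \<Rightarrow> 'e set) \<Rightarrow> ('u \<Rightarrow> real) \<Rightarrow> 'e set \<Rightarrow> 'u set"

definition is_cover :: "'u set \<Rightarrow> ('u \<Rightarrow> 'e set) \<Rightarrow> 'e set \<Rightarrow> 'u set \<Rightarrow> bool" where
  "is_cover U C X S \<longleftrightarrow> S \<subseteq> U \<and> (\<Union>u\<in>S. C u) = X"

definition cover_solver :: "real \<Rightarrow> ('u, 'e) solver \<Rightarrow> bool" where
  "cover_solver \<alpha> sol \<longleftrightarrow>
     (\<forall>U C w X. finite U \<and> finite X \<and> (\<forall>u\<in>U. C u \<subseteq> X \<and> 0 < w u) \<and> (\<exists>S. is_cover U C X S) \<longrightarrow>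
        is_cover U C X (sol U C w X) \<and>
        sum w (sol U C w X) \<le> \<alpha> * Min (sum w ` {S. is_cover U C X S}))"

definition returned_cover ::
    "('u, 'e) solver \<Rightarrow> 'u set \<Rightarrow> ('u \<Rightarrow> 'e set) \<Rightarrow> ('u \<Rightarrow> real) \<Rightarrow> 'e set \<Rightarrow> 'u set \<Rightarrow> bool" where
  "returned_cover sol U C w X S \<longleftrightarrow> S = sol U C w X \<and> is_cover U C X S"


section \<open>Well-definedness of the interaction model\<close>

lemma measurable_round_kernel:
  assumes R: "R \<in> A \<rightarrow>\<^sub>M prob_algebra Y" and \<pi>: "policy A Y \<pi>"
  shows "round_kernel A Y R \<pi> t \<in> (\<Pi>\<^sub>M s\<in>{0..<t}. A \<Otimes>\<^sub>M Y) \<rightarrow>\<^sub>M prob_algebra (A \<Otimes>\<^sub>M Y)"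
proof -
  have [measurable]: "\<pi> t \<in> (\<Pi>\<^sub>M s\<in>{0..<t}. A \<Otimes>\<^sub>M Y) \<rightarrow>\<^sub>M prob_algebra A"
    using \<pi> by (simp add: policy_def)
  note R[measurable]
  show ?thesis
    unfolding round_kernel_def by measurable
qed

lemma Ionescu_Tulcea_round_kernel:
  assumes R: "R \<in> A \<rightarrow>\<^sub>M prob_algebra Y" and \<pi>: "policy A Y \<pi>"
  shows "Ionescu_Tulcea (round_kernel A Y R \<pi>) (\<lambda>_. A \<Otimes>\<^sub>M Y)"
proof (rule Ionescu_Tulcea.intro)
  show "round_kernel A Y R \<pi> t \<in> (\<Pi>\<^sub>M s\<in>{0..<t}. A \<Otimes>\<^sub>M Y) \<rightarrow>\<^sub>M subprob_algebra (A \<Otimes>\<^sub>M Y)" for t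
    using measurable_round_kernel[OF R \<pi>] by (rule measurable_prob_algebraD)
  show "prob_space (round_kernel A Y R \<pi> t h)"
    if "h \<in> space (\<Pi>\<^sub>M s\<in>{0..<t}. A \<Otimes>\<^sub>M Y)" for t h
    using measurable_space[OF measurable_round_kernel[OF R \<pi>] that] by (simp add: space_prob_algebra)
qed

lemma filtration_history_filtration:
  "filtration (space (run_space M A Y)) (history_filtration M A Y)"
proof
  show "space (history_filtration M A Y T) = space (run_space M A Y)" for T
    by (simp add: history_filtration_def)
  show "sets (history_filtration M A Y T) \<subseteq> sets (history_filtration M A Y T')" if "T \<le> T'" for T T'
  proof -
    let ?\<Omega> = "space (run_space M A Y)"
    let ?h = "\<lambda>T (i :: nat, \<omega> :: nat \<Rightarrow> 'a \<times> 'b). restrict \<omega> {s. enat s < T}"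
    have h_meas: "?h T' \<in> history_filtration M A Y T' \<rightarrow>\<^sub>M (\<Pi>\<^sub>M s\<in>{s. enat s < T'}. A \<Otimes>\<^sub>M Y)"
      unfolding history_filtration_def
      by (rule measurable_vimage_algebra1)
         (auto simp: run_space_def space_pair_measure space_PiM PiE_iff split: if_splits)
    have "(\<lambda>\<omega>. restrict \<omega> {s. enat s < T}) \<in>
        (\<Pi>\<^sub>M s\<in>{s. enat s < T'}. A \<Otimes>\<^sub>M Y) \<rightarrow>\<^sub>M (\<Pi>\<^sub>M s\<in>{s. enat s < T}. A \<Otimes>\<^sub>M Y)"
      using that by (intro measurable_restrict_subset) auto
    from measurable_comp[OF h_meas this]
    have "?h T \<in> history_filtration M A Y T' \<rightarrow>\<^sub>M (\<Pi>\<^sub>M s\<in>{s. enat s < T}. A \<Otimes>\<^sub>M Y)"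
      by (rule measurable_cong[THEN iffD1, rotated])
         (use that in \<open>auto simp: fun_eq_iff restrict_def\<close>)
    note h = this
    have "?h T -` X \<inter> ?\<Omega> \<in> sets (history_filtration M A Y T')"
      if "X \<in> sets (\<Pi>\<^sub>M s\<in>{s. enat s < T}. A \<Otimes>\<^sub>M Y)" for X
      using measurable_sets[OF h that] by (simp add: history_filtration_def)
    then show ?thesis
      unfolding history_filtration_def[of M A Y T]
      by (subst sets_vimage_algebra2)
         (auto simp: run_space_def space_pair_measure space_PiM PiE_iff split: if_splits)
  qed
qed

lemma prob_space_run_law:
  assumes P: "\<And>i. i \<in> {1..M} \<Longrightarrow> P i \<in> A \<rightarrow>\<^sub>M prob_algebra Y" and \<pi>: "policy A Y \<pi>"
    and b: "\<And>i. i \<in> {1..M} \<Longrightarrow> 0 \<le> b i" "(\<Sum>i\<in>{1..M}. b i) = 1"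
  shows "prob_space (run_law M b A Y P \<pi>)" "sets (run_law M b A Y P \<pi>) = sets (run_space M A Y)"
proof -
  let ?B = "point_measure {1..M} (\<lambda>i. ennreal (b i))"
  let ?k = "\<lambda>i. distr (trajectory_law A Y (P i) \<pi>) (run_space M A Y) (\<lambda>\<omega>. (i, \<omega>))"
  have k: "?k i \<in> space (prob_algebra (run_space M A Y))" if i: "i \<in> {1..M}" for i
  proof -
    interpret IT: Ionescu_Tulcea "round_kernel A Y (P i) \<pi>" "\<lambda>_. A \<Otimes>\<^sub>M Y"
      by (rule Ionescu_Tulcea_round_kernel[OF P[OF i] \<pi>])
    have "emeasure IT.PF.lim (space (PiM UNIV (\<lambda>_. A \<Otimes>\<^sub>M Y))) = emeasure (IT.CI {}) {\<lambda>_. undefined}"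
      using IT.lim[of "{}" "{\<lambda>_. undefined}"]
      by (simp add: prod_emb_def space_PiM sets_PiM_empty restrict_def vimage_def)
    also have "\<dots> = 1"
      using prob_space.emeasure_space_1[OF IT.PF.prob_space_P[of "{}"]]
        IT.PF.space_P[of "{}"] by (simp add: space_PiM)
    finally have "prob_space (trajectory_law A Y (P i) \<pi>)"
      by (intro prob_spaceI) (simp add: trajectory_law_def)
    moreover have "(\<lambda>\<omega>. (i, \<omega>)) \<in> trajectory_law A Y (P i) \<pi> \<rightarrow>\<^sub>M run_space M A Y"
      unfolding run_space_def trajectory_law_def
      by (rule measurable_Pair) (use i in \<open>simp_all add: measurable_ident_sets\<close>)
    ultimately show ?thesis
      by (simp add: space_prob_algebra prob_space.prob_space_distr)
  qed
  have k': "?k \<in> ?B \<rightarrow>\<^sub>M prob_algebra (run_space M A Y)"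
    using k by (simp add: measurable_point_measure_eq1)
  have M: "{1..M} \<noteq> {}"
    using b(2) by force
  have "(\<Sum>i\<in>{1..M}. ennreal (b i)) = 1"
    using b by (subst sum_ennreal) auto
  then have "prob_space ?B"
    by (intro prob_spaceI) (simp add: emeasure_point_measure_finite space_point_measure)
  then have B: "?B \<in> space (prob_algebra ?B)"
    by (simp add: space_prob_algebra)
  show "prob_space (run_law M b A Y P \<pi>)"
    unfolding run_law_def using prob_space_bind'[OF B k'] .
  show "sets (run_law M b A Y P \<pi>) = sets (run_space M A Y)"
    unfolding run_law_def using sets_bind'[OF B k'] .
qed

end

theory Submission
  imports Defs
begin

text \<open>Calibration: an \<open>L\<^sup>1\<close> norm on \<open>{1..K}\<close> is the maximum of \<open>2 ^ K\<close> signed sums, and each signed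
  sum of the difference of two empirical laws is a sum of \<open>2 * n\<close> independent bounded terms, so
  Hoeffding's inequality and a union bound over signs, pairs and evaluations show that all
  empirical distances are within \<open>g / 2\<close> of the true ones except with probability \<open>\<beta>\<close>; thresholding
  at the midpoint then sandwiches the empirical cover sets.

  Inner value: a separating design identifies the unknown index by a tournament with \<open>M - 1\<close> blocks
  of equal length, in which the current champion meets the next candidate on an evaluation that
  separates the two.  The true index loses a given block with probability at most
  \<open>exp (- N * \<eta>\<^sup>2 / 8)\<close>, because the exponentially tilted scores form a supermartingale along the
  Ionescu-Tulcea construction.\<close>


section \<open>Supermartingales on the trajectory space\<close>

text \<open>Which two candidates meet in a block depends on earlier responses, so the scores of a
  block are not a sum of terms fixed in advance. What is uniform is conditional: given the history,
  the pair and its evaluation are determined, and one response has an exponential moment below the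
  same constant whichever pair it is. The true index may be the champion or the challenger, so a
  single score must serve both sides.

  The 8 in the block length comes from scores that range over an interval of length 2 and have mean
  at least \<eta> / 2 towards the true side: Hoeffding's lemma at tilt l gives the exponent - l *
  \<eta> / 2 + l^2 / 2, least at l = \<eta> / 2 with value - \<eta>^2 / 8. The number
  \<open>M - 1\<close> occurs twice, as the number of blocks and as the number of events in the
  union bound; blocks without the true index cannot eliminate it.

  The evaluations are chosen with the true laws, as the infimum in \<open>inner_value\<close>
  permits; the calibration samples only decide which design is available.\<close>

lemma (in Ionescu_Tulcea) nn_integral_lim_finite_horizon:
  assumes g[measurable]: "g \<in> borel_measurable (PiM {0..<T} M)"
    and dep: "\<And>\<omega>. g (restrict \<omega> {0..<T}) = g \<omega>"
  shows "(\<integral>\<^sup>+\<omega>. g \<omega> \<partial>PF.lim) = (\<integral>\<^sup>+\<omega>. g \<omega> \<partial>C 0 T (\<lambda>_. undefined))"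
proof -
  \<comment> \<open>\<open>CI J\<close> is the marginal on \<open>J\<close> of \<open>C\<close> run
    up to the least bound of \<open>J\<close>; on an initial segment this bound is \<open>T\<close>
    and nothing is integrated out.\<close>
  have "up_to {0..<T} = T"
    using up_to_less[of "{0..<T}" "T - 1"] up_to_iff[of "{0..<T}" T] by (cases T) (simp_all add: le_antisym Suc_leI)
  then have distr: "distr PF.lim (PiM {0..<T} M) (\<lambda>\<omega>. restrict \<omega> {0..<T}) = C 0 T (\<lambda>_. undefined)"
    using distr_C[of T T "\<lambda>_. undefined" 0] by (simp add: distr_lim CI_def)
  have "(\<lambda>\<omega>. restrict \<omega> {0..<T}) \<in> PF.lim \<rightarrow>\<^sub>M PiM {0..<T} M"
    by (subst measurable_cong_sets[OF PF.sets_lim refl]) (auto intro!: measurable_restrict_subset)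
  then have "(\<integral>\<^sup>+\<omega>. g (restrict \<omega> {0..<T}) \<partial>PF.lim) = (\<integral>\<^sup>+\<omega>. g \<omega> \<partial>C 0 T (\<lambda>_. undefined))"
    unfolding distr[symmetric] by (subst nn_integral_distr) (simp_all add: g)
  then show ?thesis
    by (simp only: dep)
qed

text \<open>The last round is integrated first: given the history its factor integrates to at most
  1, and by \<open>dep\<close> the earlier factors do not see it, so they come out of the integral.
  Measurability is asked on every longer segment because a product over rounds needs one common
  space.\<close>

lemma (in Ionescu_Tulcea) nn_integral_prod_le_one:
  assumes f: "\<And>t T. t < T \<Longrightarrow> f t \<in> borel_measurable (PiM {0..<T} M)"
    and dep: "\<And>t h h'. (\<And>s. s \<le> t \<Longrightarrow> h s = h' s) \<Longrightarrow> f t h = f t h'"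
    and step: "\<And>t h. h \<in> space (PiM {0..<t} M) \<Longrightarrow> (\<integral>\<^sup>+z. f t (h(t := z)) \<partial>P t h) \<le> (1::ennreal)"
  shows "(\<integral>\<^sup>+\<omega>. (\<Prod>t<T. f t \<omega>) \<partial>PF.lim) \<le> 1"
proof -
  have "(\<integral>\<^sup>+\<omega>. (\<Prod>t<T. f t \<omega>) \<partial>C 0 T (\<lambda>_. undefined)) \<le> 1"
  proof (induction T)
    case 0
    show ?case by (simp add: emeasure_return indicator_def)
  next
    case (Suc T)
    note f[measurable]
    have "(\<integral>\<^sup>+\<omega>. (\<Prod>t<Suc T. f t \<omega>) \<partial>C 0 (Suc T) (\<lambda>_. undefined))
        = (\<integral>\<^sup>+h. \<integral>\<^sup>+\<omega>. (\<Prod>t<Suc T. f t \<omega>) \<partial>eP T h \<partial>C 0 T (\<lambda>_. undefined))"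
      by (simp del: prod.lessThan_Suc)
        (rule nn_integral_bind[where B="PiM {0..<Suc T} M"],
         auto simp: measurable_cong_sets[OF sets_C refl] intro!: borel_measurable_prod_ennreal f measurable_eP)
    also have "\<dots> \<le> (\<integral>\<^sup>+h. (\<Prod>t<T. f t h) \<partial>C 0 T (\<lambda>_. undefined))"
    proof (rule nn_integral_mono)
      fix h assume "h \<in> space (C 0 T (\<lambda>_. undefined))"
      then have h: "h \<in> space (PiM {0..<T} M)" by (simp add: space_C)
      have "(\<integral>\<^sup>+\<omega>. (\<Prod>t<Suc T. f t \<omega>) \<partial>eP T h) = (\<integral>\<^sup>+z. (\<Prod>t<Suc T. f t (h(T := z))) \<partial>P T h)"
        using h by (rule nn_integral_eP) (auto intro!: borel_measurable_prod_ennreal f)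
      also have "\<dots> = (\<integral>\<^sup>+z. (\<Prod>t<T. f t h) * f T (h(T := z)) \<partial>P T h)"
      proof (rule nn_integral_cong)
        fix z
        have "(\<Prod>t<T. f t (h(T := z))) = (\<Prod>t<T. f t h)"
          by (intro prod.cong refl dep) auto
        then show "(\<Prod>t<Suc T. f t (h(T := z))) = (\<Prod>t<T. f t h) * f T (h(T := z))"
          by simp
      qed
      also have "\<dots> = (\<Prod>t<T. f t h) * (\<integral>\<^sup>+z. f T (h(T := z)) \<partial>P T h)"
      proof (rule nn_integral_cmult)
        have "(\<lambda>z. h(T := z)) \<in> M T \<rightarrow>\<^sub>M PiM {0..<Suc T} M"
          using h by (intro measurable_fun_upd[where J="{0..<T}"]) auto
        then have "(\<lambda>z. h(T := z)) \<in> P T h \<rightarrow>\<^sub>M PiM {0..<Suc T} M"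
          by (simp add: measurable_cong_sets[OF sets_P[OF h] refl])
        from measurable_compose[OF this f[of T "Suc T"]]
        show "(\<lambda>z. f T (h(T := z))) \<in> borel_measurable (P T h)" by simp
      qed
      also have "\<dots> \<le> (\<Prod>t<T. f t h)"
        using mult_left_mono[OF step[OF h], of "\<Prod>t<T. f t h"] by simp
      finally show "(\<integral>\<^sup>+\<omega>. (\<Prod>t<Suc T. f t \<omega>) \<partial>eP T h) \<le> (\<Prod>t<T. f t h)" .
    qed
    also have "\<dots> \<le> 1" by fact
    finally show ?case .
  qed
  then show ?thesis
    by (subst nn_integral_lim_finite_horizon[where T=T])
      (auto intro!: borel_measurable_prod_ennreal f prod.cong dep)
qed

section \<open>The tournament\<close>

text \<open>\<open>v c d y\<close> is the score of the response \<open>y\<close> in favour of \<open>c\<close> against \<open>d\<close>.  Block \<open>r\<close> consists of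
  the rounds \<open>r * N, \<dots>, r * N + N - 1\<close>; in it the champion meets the challenger \<open>r + 2\<close>, and the
  winner is the champion after \<open>r + 1\<close> blocks.\<close>

fun champion :: "(nat \<Rightarrow> nat \<Rightarrow> 'y \<Rightarrow> real) \<Rightarrow> nat \<Rightarrow> (nat \<Rightarrow> 'a \<times> 'y) \<Rightarrow> nat \<Rightarrow> nat" where
  "champion v N h 0 = 1"
| "champion v N h (Suc r) =
     (if 0 \<le> (\<Sum>s = r * N..<Suc r * N. v (champion v N h r) (r + 2) (snd (h s)))
      then champion v N h r else r + 2)"

declare champion.simps(2)[simp del]

lemma champion_ge_1: "1 \<le> champion v N h r"
  by (induction r) (auto simp: champion.simps(2))

text \<open>The challenger \<open>r + 2\<close> comes after all indices met so far, so the champion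
  is always the smaller index of a pair. Hence scores and moment bounds are only needed for
  \<open>c < d\<close>.\<close>

lemma champion_le: "champion v N h r \<le> r + 1"
  by (induction r) (auto simp: champion.simps(2))

lemma champion_cong:
  "(\<And>s. s < r * N \<Longrightarrow> h s = h' s) \<Longrightarrow> champion v N h r = champion v N h' r"
proof (induction r)
  case (Suc r)
  have "champion v N h r = champion v N h' r"
    by (intro Suc) auto
  moreover have "(\<Sum>s = r * N..<Suc r * N. v c (r + 2) (snd (h s))) =
      (\<Sum>s = r * N..<Suc r * N. v c (r + 2) (snd (h' s)))" for c
    using Suc.prems by (intro sum.cong refl) auto
  ultimately show ?case by (simp add: champion.simps(2) del: sum.op_ivl_Suc)
qed simp

text \<open>The index set \<open>J\<close> is left free because the champion is read off finite
  histories, off the stopped history and off whole trajectories. Since it takes countably many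
  values, the random score in the recursion is handled by fixing the champion first.\<close>

lemma measurable_champion:
  assumes v: "\<And>c d. v c d \<in> borel_measurable Y" and J: "{0..<r * N} \<subseteq> J"
  shows "(\<lambda>h. champion v N h r) \<in> (\<Pi>\<^sub>M s\<in>J. A \<Otimes>\<^sub>M Y) \<rightarrow>\<^sub>M count_space UNIV"
  using J
proof (induction r)
  case (Suc r)
  note v[measurable]
  have [measurable]: "(\<lambda>h. champion v N h r) \<in> (\<Pi>\<^sub>M s\<in>J. A \<Otimes>\<^sub>M Y) \<rightarrow>\<^sub>M count_space UNIV"
    using Suc.prems by (intro Suc.IH) auto
  have [measurable]: "(\<lambda>h. \<Sum>s = r * N..<Suc r * N. v c (r + 2) (snd (h s))) \<in> borel_measurable (\<Pi>\<^sub>M s\<in>J. A \<Otimes>\<^sub>M Y)" for c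
  proof (rule borel_measurable_sum)
    fix s assume "s \<in> {r * N..<Suc r * N}"
    then have "s \<in> J" using Suc.prems by auto
    then show "(\<lambda>h. v c (r + 2) (snd (h s))) \<in> borel_measurable (\<Pi>\<^sub>M s\<in>J. A \<Otimes>\<^sub>M Y)"
      by measurable
  qed
  show ?case
    unfolding champion.simps
    by (rule measurable_compose_countable[where g="\<lambda>h. champion v N h r"
          and f="\<lambda>c h. if 0 \<le> (\<Sum>s = r * N..<Suc r * N. v c (r + 2) (snd (h s))) then c else r + 2"])
      measurable
qed simp

text \<open>Only the blocks that \<open>i\<close> plays matter: it is the initial champion if
  \<open>i = 1\<close>, enters as challenger in block \<open>i - 2\<close> otherwise, and stays as
  long as it wins.\<close>

lemma champion_eqI:
  assumes "1 \<le> i" "i \<le> R + 1"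
    and win: "\<And>r. r < R \<Longrightarrow> champion v N h r = i \<or> r + 2 = i \<Longrightarrow> champion v N h (Suc r) = i"
  shows "champion v N h R = i"
proof -
  have "i \<le> r + 1 \<Longrightarrow> r \<le> R \<Longrightarrow> champion v N h r = i" for r
  proof (induction r)
    case 0 then show ?case using assms by simp
  next
    case (Suc r)
    show ?case
    proof (cases "i \<le> r + 1")
      case True then show ?thesis using Suc by (intro win) auto
    next
      case False then show ?thesis using Suc.prems by (intro win) auto
    qed
  qed
  then show ?thesis using assms by simp
qed

text \<open>\<open>l\<close> is the tilt and \<rho> the bound per response on the exponential
  moments, once with the champion and once with the challenger as the true index.
  \<open>probe\<close> and \<open>v\<close> are total: a policy must act at every round, also after
  block \<open>M - 2\<close>, where the challenger \<open>r + 2\<close> exceeds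
  \<open>M\<close>.\<close>

locale tournament =
  fixes M N :: nat and A :: "'a measure" and Y :: "'y measure" and P :: "nat \<Rightarrow> 'a \<Rightarrow> 'y measure"
    and probe :: "nat \<Rightarrow> nat \<Rightarrow> 'a" and v :: "nat \<Rightarrow> nat \<Rightarrow> 'y \<Rightarrow> real" and l \<rho> :: real
  assumes N: "0 < N"
    and P: "\<And>i. i \<in> {1..M} \<Longrightarrow> P i \<in> A \<rightarrow>\<^sub>M prob_algebra Y"
    and probe: "\<And>c d. probe c d \<in> space A"
    and v: "\<And>c d. v c d \<in> borel_measurable Y"
    and l: "0 \<le> l" and \<rho>: "0 < \<rho>"
    and mgf_champion: "\<And>c d. 1 \<le> c \<Longrightarrow> c < d \<Longrightarrow> d \<le> M \<Longrightarrow>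
      (\<integral>\<^sup>+y. ennreal (exp (- l * v c d y)) \<partial>P c (probe c d)) \<le> ennreal \<rho>"
    and mgf_challenger: "\<And>c d. 1 \<le> c \<Longrightarrow> c < d \<Longrightarrow> d \<le> M \<Longrightarrow>
      (\<integral>\<^sup>+y. ennreal (exp (l * v c d y)) \<partial>P d (probe c d)) \<le> ennreal \<rho>"
begin

abbreviation champ :: "(nat \<Rightarrow> 'a \<times> 'y) \<Rightarrow> nat \<Rightarrow> nat" where
  "champ \<equiv> champion v N"

definition play :: "nat \<Rightarrow> (nat \<Rightarrow> 'a \<times> 'y) \<Rightarrow> 'a" where
  "play t h = probe (champ h (t div N)) (t div N + 2)"

definition king_policy :: "nat \<Rightarrow> (nat \<Rightarrow> 'a \<times> 'y) \<Rightarrow> 'a measure" where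
  "king_policy t h = return A (play t h)"

lemma play_space: "play t h \<in> space A"
  by (simp add: play_def probe)

lemma policy_king: "policy A Y king_policy"
  unfolding policy_def
proof
  fix t
  \<comment> \<open>Block \<open>t div N\<close> starts no later than round \<open>t\<close>, so its
    champion is a function of the history.\<close>
  have [measurable]: "(\<lambda>h. champ h (t div N)) \<in> (\<Pi>\<^sub>M s\<in>{0..<t}. A \<Otimes>\<^sub>M Y) \<rightarrow>\<^sub>M count_space UNIV"
    by (rule measurable_champion[OF v]) simp
  have "play t \<in> (\<Pi>\<^sub>M s\<in>{0..<t}. A \<Otimes>\<^sub>M Y) \<rightarrow>\<^sub>M A"
    unfolding play_def
    by (rule measurable_compose[of "\<lambda>h. champ h (t div N)" _ "count_space UNIV"]) (auto simp: probe)
  then show "king_policy t \<in> (\<Pi>\<^sub>M s\<in>{0..<t}. A \<Otimes>\<^sub>M Y) \<rightarrow>\<^sub>M prob_algebra A"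
    unfolding king_policy_def by measurable
qed

lemma nn_integral_round_king:
  assumes i: "i \<in> {1..M}" and g: "g \<in> borel_measurable (A \<Otimes>\<^sub>M Y)"
  shows "(\<integral>\<^sup>+z. g z \<partial>round_kernel A Y (P i) king_policy t h) =
    (\<integral>\<^sup>+y. g (play t h, y) \<partial>P i (play t h))"
proof -
  have kernel: "(\<lambda>a. P i a \<bind> (\<lambda>y. return (A \<Otimes>\<^sub>M Y) (a, y))) \<in> A \<rightarrow>\<^sub>M prob_algebra (A \<Otimes>\<^sub>M Y)"
    by (rule measurable_bind_prob_space2[OF P[OF i]]) measurable
  have a: "play t h \<in> space A" by (rule play_space)
  have sets_Pa: "sets (P i (play t h)) = sets Y"
    using measurable_space[OF P[OF i] a] by (simp add: space_prob_algebra)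
  have round: "round_kernel A Y (P i) king_policy t h =
      P i (play t h) \<bind> (\<lambda>y. return (A \<Otimes>\<^sub>M Y) (play t h, y))"
    unfolding round_kernel_def king_policy_def
    by (rule bind_return[OF measurable_prob_algebraD[OF kernel] a])
  have "(\<integral>\<^sup>+z. g z \<partial>round_kernel A Y (P i) king_policy t h) =
      (\<integral>\<^sup>+y. \<integral>\<^sup>+z. g z \<partial>return (A \<Otimes>\<^sub>M Y) (play t h, y) \<partial>P i (play t h))"
    unfolding round
  proof (rule nn_integral_bind[OF g])
    show "(\<lambda>y. return (A \<Otimes>\<^sub>M Y) (play t h, y)) \<in> P i (play t h) \<rightarrow>\<^sub>M subprob_algebra (A \<Otimes>\<^sub>M Y)"
      unfolding measurable_cong_sets[OF sets_Pa refl]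
      by (rule measurable_compose[OF measurable_Pair1'[OF a] return_measurable])
  qed
  also have "\<dots> = (\<integral>\<^sup>+y. g (play t h, y) \<partial>P i (play t h))"
  proof (rule nn_integral_cong)
    fix y assume "y \<in> space (P i (play t h))"
    then have "(play t h, y) \<in> space (A \<Otimes>\<^sub>M Y)"
      using a by (simp add: sets_eq_imp_space_eq[OF sets_Pa] space_pair_measure)
    then show "(\<integral>\<^sup>+z. g z \<partial>return (A \<Otimes>\<^sub>M Y) (play t h, y)) = g (play t h, y)"
      using g by (rule nn_integral_return)
  qed
  finally show ?thesis .
qed

text \<open>If \<open>i\<close> loses block \<open>r\<close>, the product of these factors is at least \<open>1 / \<rho> ^ N\<close>, while its
  expectation under the candidate \<open>i\<close> is at most 1; Markov's inequality bounds the probability of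
  that loss without any independence argument.\<close>

definition factor :: "nat \<Rightarrow> nat \<Rightarrow> nat \<Rightarrow> (nat \<Rightarrow> 'a \<times> 'y) \<Rightarrow> real" where
  "factor i r t h =
     (if t div N \<noteq> r then 1
      else if champ h r = i then exp (- l * v i (r + 2) (snd (h t))) / \<rho>
      else if r + 2 = i then exp (l * v (champ h r) i (snd (h t))) / \<rho>
      else 1)"

lemma factor_nonneg: "0 \<le> factor i r t h"
  using \<rho> by (simp add: factor_def)

lemma factor_cong:
  assumes "\<And>s. s \<le> t \<Longrightarrow> h s = h' s"
  shows "factor i r t h = factor i r t h'"
proof (cases "t div N = r")
  case True
  have "r * N \<le> t" unfolding True[symmetric] by simp
  then have "champ h r = champ h' r"
    using assms by (intro champion_cong) simp
  then show ?thesis using assms[of t] by (simp add: factor_def)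
qed (simp add: factor_def)

lemma measurable_factor:
  assumes "t < T"
  shows "factor i r t \<in> borel_measurable (\<Pi>\<^sub>M s\<in>{0..<T}. A \<Otimes>\<^sub>M Y)"
proof (cases "t div N = r")
  case True
  note v[measurable]
  have t[measurable]: "t \<in> {0..<T}" using assms by simp
  have [measurable]: "(\<lambda>h. champ h r) \<in> (\<Pi>\<^sub>M s\<in>{0..<T}. A \<Otimes>\<^sub>M Y) \<rightarrow>\<^sub>M count_space UNIV"
    using assms div_times_less_eq_dividend[of t N] unfolding True
    by (intro measurable_champion[OF v]) simp
  have "(\<lambda>h. if c = i then exp (- l * v i (r + 2) (snd (h t))) / \<rho>
      else if r + 2 = i then exp (l * v c i (snd (h t))) / \<rho> else 1)
    \<in> borel_measurable (\<Pi>\<^sub>M s\<in>{0..<T}. A \<Otimes>\<^sub>M Y)" for c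
    by measurable
  from measurable_compose_countable[where g="\<lambda>h. champ h r", OF this]
  show ?thesis
    using True unfolding factor_def[abs_def] by simp
qed (simp add: factor_def[abs_def])

text \<open>Round \<open>t\<close> comes after the champion of its block was settled: changing
  coordinate \<open>t\<close> leaves \<open>champ h r\<close> alone, and the integral is the
  one-response exponential moment of the fixed pair \<open>(c, r + 2)\<close>, divided by its bound
  \<rho>. The hypothesis \<open>r + 2 \<le> M\<close> makes this a pair for which the locale
  supplies moments.\<close>

lemma nn_integral_factor_le_1:
  assumes i: "i \<in> {1..M}" and r: "r + 2 \<le> M"
  shows "(\<integral>\<^sup>+z. ennreal (factor i r t (h(t := z))) \<partial>round_kernel A Y (P i) king_policy t h) \<le> 1"
proof (cases "t div N = r")
  case False
  then show ?thesis
    using nn_integral_round_king[OF i, of "\<lambda>_. 1" t h]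
      measurable_space[OF P[OF i] play_space[of t h]]
    by (simp add: factor_def space_prob_algebra prob_space.emeasure_space_1)
next
  case True
  note v[measurable]
  have champ_upd: "champ (h(t := z)) r = champ h r" for z
  proof (rule champion_cong)
    fix s assume "s < r * N"
    also have "\<dots> \<le> t" unfolding True[symmetric] by simp
    finally show "(h(t := z)) s = h s" by simp
  qed
  define c where "c = champ h r"
  have c: "1 \<le> c" "c < r + 2"
    using champion_ge_1[of v N h r] champion_le[of v N h r] by (auto simp: c_def)
  have play: "play t h = probe c (r + 2)"
    by (simp add: play_def c_def True)
  let ?R = "round_kernel A Y (P i) king_policy t h"
  have normal: "(\<integral>\<^sup>+y. ennreal (exp (w y) / \<rho>) \<partial>\<nu>) \<le> 1"
    if "(\<integral>\<^sup>+y. ennreal (exp (w y)) \<partial>\<nu>) \<le> ennreal \<rho>" "w \<in> borel_measurable Y" "sets \<nu> = sets Y" for w and \<nu> :: "'y measure"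
  proof -
    have "(\<integral>\<^sup>+y. ennreal (exp (w y) / \<rho>) \<partial>\<nu>) = ennreal (1 / \<rho>) * (\<integral>\<^sup>+y. ennreal (exp (w y)) \<partial>\<nu>)"
      using that(2) \<rho>
      by (subst nn_integral_cmult[symmetric])
        (auto simp: measurable_cong_sets[OF that(3) refl] simp flip: ennreal_mult)
    also have "\<dots> \<le> ennreal (1 / \<rho>) * ennreal \<rho>"
      by (intro mult_left_mono that) simp
    also have "\<dots> = 1"
      using \<rho> by (simp flip: ennreal_mult)
    finally show ?thesis .
  qed
  have sets_P: "sets (P i (play t h)) = sets Y"
    using measurable_space[OF P[OF i] play_space[of t h]] by (simp add: space_prob_algebra)
  consider "c = i" | "c \<noteq> i" "r + 2 = i" | "c \<noteq> i" "r + 2 \<noteq> i" by blast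
  then show ?thesis
  proof cases
    case 1
    have "(\<integral>\<^sup>+z. ennreal (factor i r t (h(t := z))) \<partial>?R) =
        (\<integral>\<^sup>+z. ennreal (exp (- l * v i (r + 2) (snd z)) / \<rho>) \<partial>?R)"
      using 1 True by (simp add: factor_def champ_upd c_def)
    also have "\<dots> = (\<integral>\<^sup>+y. ennreal (exp (- l * v i (r + 2) y) / \<rho>) \<partial>P i (play t h))"
      by (subst nn_integral_round_king[OF i]) auto
    also have "\<dots> \<le> 1"
      using 1 c r mgf_champion[of c "r + 2"]
      by (intro normal sets_P) (auto simp: play)
    finally show ?thesis .
  next
    case 2
    have "(\<integral>\<^sup>+z. ennreal (factor i r t (h(t := z))) \<partial>?R) =
        (\<integral>\<^sup>+z. ennreal (exp (l * v c i (snd z)) / \<rho>) \<partial>?R)"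
      using 2 True by (simp add: factor_def champ_upd c_def)
    also have "\<dots> = (\<integral>\<^sup>+y. ennreal (exp (l * v c i y) / \<rho>) \<partial>P i (play t h))"
      by (subst nn_integral_round_king[OF i]) auto
    also have "\<dots> \<le> 1"
      using 2 c r mgf_challenger[of c "r + 2"]
      by (intro normal sets_P) (auto simp: play)
    finally show ?thesis .
  next
    \<comment> \<open>\<open>i\<close> does not play this block, so the factor is 1 and only the
      mass of the round kernel remains.\<close>
    case 3
    then show ?thesis
      using True nn_integral_round_king[OF i, of "\<lambda>_. 1" t h]
        measurable_space[OF P[OF i] play_space[of t h]]
      by (simp add: factor_def champ_upd c_def space_prob_algebra prob_space.emeasure_space_1)
  qed
qed

text \<open>The factors off the block are 1; those on it multiply to \<open>exp\<close> of
  \<open>l\<close> times the total score against \<open>i\<close>, over \<open>\<rho> ^ N\<close>.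
  Losing makes that total nonnegative. A tie, decided for the champion, is a loss of the challenger
  with total 0, which is still enough.\<close>

lemma prod_factor_block:
  assumes lose: "champ h r = i \<or> r + 2 = i" "champ h (Suc r) \<noteq> i" and r: "r < R"
  shows "1 / \<rho> ^ N \<le> (\<Prod>t<R * N. factor i r t h)"
proof -
  let ?B = "{r * N..<Suc r * N}"
  let ?D = "\<Sum>s\<in>?B. v (champ h r) (r + 2) (snd (h s))"
  have "t div N = r \<longleftrightarrow> r \<le> t div N \<and> t div N < Suc r" for t
    by auto
  then have B: "t div N = r \<longleftrightarrow> t \<in> ?B" for t
    by (simp only: less_eq_div_iff_mult_less_eq[OF N] div_less_iff_less_mult[OF N] atLeastLessThan_iff)
  have "Suc r * N \<le> R * N"
    using r by (intro mult_right_mono) auto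
  then have "?B \<subseteq> {..<R * N}" by auto
  then have "(\<Prod>t<R * N. factor i r t h) = (\<Prod>t\<in>?B. factor i r t h)"
    by (intro prod.mono_neutral_right) (auto simp: factor_def B)
  also have "\<dots> \<ge> 1 / \<rho> ^ N"
  proof (cases "champ h r = i")
    case True
    then have "?D < 0"
      using lose by (auto simp: champion.simps(2) simp del: sum.op_ivl_Suc split: if_splits)
    have "(\<Prod>t\<in>?B. factor i r t h) = (\<Prod>t\<in>?B. exp (- l * v (champ h r) (r + 2) (snd (h t))) / \<rho>)"
      using True by (intro prod.cong refl) (simp add: factor_def B)
    also have "\<dots> = exp (- l * ?D) / \<rho> ^ N"
      by (simp add: prod_dividef exp_sum[symmetric] sum_distrib_left del: prod.op_ivl_Suc sum.op_ivl_Suc)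
    also have "\<dots> \<ge> 1 / \<rho> ^ N"
      using \<rho> l \<open>?D < 0\<close>
      by (intro divide_right_mono) (auto simp: mult_nonneg_nonpos simp del: sum.op_ivl_Suc)
    finally show ?thesis .
  next
    case False
    then have "r + 2 = i" "0 \<le> ?D"
      using lose by (auto simp: champion.simps(2) simp del: sum.op_ivl_Suc split: if_splits)
    have "(\<Prod>t\<in>?B. factor i r t h) = (\<Prod>t\<in>?B. exp (l * v (champ h r) (r + 2) (snd (h t))) / \<rho>)"
      using False \<open>r + 2 = i\<close> by (intro prod.cong refl) (simp add: factor_def B)
    also have "\<dots> = exp (l * ?D) / \<rho> ^ N"
      by (simp add: prod_dividef exp_sum[symmetric] sum_distrib_left del: prod.op_ivl_Suc sum.op_ivl_Suc)
    also have "\<dots> \<ge> 1 / \<rho> ^ N"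
      using \<rho> l \<open>0 \<le> ?D\<close>
      by (intro divide_right_mono) (auto simp del: sum.op_ivl_Suc)
    finally show ?thesis .
  qed
  finally show ?thesis .
qed

lemma champ_error:
  assumes i: "i \<in> {1..M}" and M: "2 \<le> M"
  shows "emeasure (trajectory_law A Y (P i) king_policy)
      {\<omega> \<in> space (\<Pi>\<^sub>M t\<in>UNIV. A \<Otimes>\<^sub>M Y). champ \<omega> (M - 1) \<noteq> i} \<le> ennreal ((real M - 1) * \<rho> ^ N)"
proof -
  interpret IT: Ionescu_Tulcea "round_kernel A Y (P i) king_policy" "\<lambda>_. A \<Otimes>\<^sub>M Y"
    by (rule Ionescu_Tulcea_round_kernel[OF P[OF i] policy_king])
  define T where "T = trajectory_law A Y (P i) king_policy"
  have T: "T = IT.PF.lim" by (simp add: T_def trajectory_law_def)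
  have sets_T[measurable_cong]: "sets T = sets (\<Pi>\<^sub>M t\<in>UNIV. A \<Otimes>\<^sub>M Y)"
    by (simp add: T)
  have space_T: "space T = space (\<Pi>\<^sub>M t\<in>UNIV. A \<Otimes>\<^sub>M Y)"
    using sets_T by (rule sets_eq_imp_space_eq)
  have [measurable]: "(\<lambda>h. champ h r) \<in> T \<rightarrow>\<^sub>M count_space UNIV" for r
    by (subst measurable_cong_sets[OF sets_T refl], rule measurable_champion[OF v]) simp
  \<comment> \<open>\<open>i\<close> plays block \<open>r\<close> and does not come out as champion.
    By \<open>champion_eqI\<close> the error event lies in the union of these \<open>M - 1\<close>
    events.\<close>
  define L where "L r = {\<omega> \<in> space T. (champ \<omega> r = i \<or> r + 2 = i) \<and> champ \<omega> (Suc r) \<noteq> i}" for r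
  have L[measurable]: "L r \<in> sets T" for r
    unfolding L_def by measurable
  have "emeasure T (L r) \<le> ennreal (\<rho> ^ N)" if "r < M - 1" for r
  proof -
    \<comment> \<open>The horizon reaches to the end of the last block, so the same range of rounds
      works for every \<open>r\<close>.\<close>
    let ?W = "\<lambda>\<omega>. \<Prod>t<(M - 1) * N. ennreal (factor i r t \<omega>)"
    have W: "?W \<in> borel_measurable T"
    proof -
      have "factor i r t \<in> borel_measurable T" for t
      proof -
        have "(\<lambda>\<omega>. restrict \<omega> {0..<Suc t}) \<in> T \<rightarrow>\<^sub>M (\<Pi>\<^sub>M s\<in>{0..<Suc t}. A \<Otimes>\<^sub>M Y)"
          by (subst measurable_cong_sets[OF sets_T refl]) (auto intro!: measurable_restrict_subset)
        from measurable_compose[OF this measurable_factor[of t "Suc t" i r]]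
        have "(\<lambda>\<omega>. factor i r t (restrict \<omega> {0..<Suc t})) \<in> borel_measurable T"
          by simp
        moreover have "factor i r t (restrict \<omega> {0..<Suc t}) = factor i r t \<omega>" for \<omega>
          by (rule factor_cong) simp
        ultimately show ?thesis by simp
      qed
      then show ?thesis by (intro borel_measurable_prod_ennreal) auto
    qed
    have "(\<integral>\<^sup>+\<omega>. ?W \<omega> \<partial>T) \<le> 1"
      unfolding T
    proof (rule IT.nn_integral_prod_le_one)
      show "(\<lambda>\<omega>. ennreal (factor i r t \<omega>)) \<in> borel_measurable (\<Pi>\<^sub>M s\<in>{0..<U}. A \<Otimes>\<^sub>M Y)" if "t < U" for t U
        using measurable_factor[OF that] by simp
      show "ennreal (factor i r t h) = ennreal (factor i r t h')" if "\<And>s. s \<le> t \<Longrightarrow> h s = h' s" for t h h'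
        using factor_cong[OF that] by simp
      show "(\<integral>\<^sup>+z. ennreal (factor i r t (h(t := z))) \<partial>round_kernel A Y (P i) king_policy t h) \<le> 1" for t h
        by (rule nn_integral_factor_le_1[OF i]) (use that in simp)
    qed
    have "L r \<subseteq> {\<omega> \<in> space T. 1 \<le> ennreal (\<rho> ^ N) * ?W \<omega>}"
    proof
      fix \<omega> assume "\<omega> \<in> L r"
      then have "1 / \<rho> ^ N \<le> (\<Prod>t<(M - 1) * N. factor i r t \<omega>)" "\<omega> \<in> space T"
        using that by (auto simp: L_def intro!: prod_factor_block)
      then have "1 \<le> \<rho> ^ N * (\<Prod>t<(M - 1) * N. factor i r t \<omega>)"
        using \<rho> by (simp add: field_simps)
      then have "ennreal 1 \<le> ennreal (\<rho> ^ N * (\<Prod>t<(M - 1) * N. factor i r t \<omega>))"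
        by (rule ennreal_leI)
      also have "\<dots> = ennreal (\<rho> ^ N) * ?W \<omega>"
        using \<rho> by (simp add: ennreal_mult prod_nonneg factor_nonneg prod_ennreal)
      finally show "\<omega> \<in> {\<omega> \<in> space T. 1 \<le> ennreal (\<rho> ^ N) * ?W \<omega>}"
        using \<open>\<omega> \<in> space T\<close> by simp
    qed
    then have "emeasure T (L r) \<le> emeasure T {\<omega> \<in> space T. 1 \<le> ennreal (\<rho> ^ N) * ?W \<omega>}"
      using W by (intro emeasure_mono) auto
    also have "\<dots> \<le> ennreal (\<rho> ^ N) * (\<integral>\<^sup>+\<omega>. ?W \<omega> * indicator (space T) \<omega> \<partial>T)"
      using nn_integral_Markov_inequality[OF _ sets.top, of ?W T "ennreal (\<rho> ^ N)"] W by simp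
    also have "(\<integral>\<^sup>+\<omega>. ?W \<omega> * indicator (space T) \<omega> \<partial>T) = (\<integral>\<^sup>+\<omega>. ?W \<omega> \<partial>T)"
      by (intro nn_integral_cong) simp
    also have "ennreal (\<rho> ^ N) * \<dots> \<le> ennreal (\<rho> ^ N) * 1"
      by (intro mult_left_mono) (fact, simp)
    finally show ?thesis by simp
  qed
  then have "(\<Sum>r<M - 1. emeasure T (L r)) \<le> (\<Sum>r<M - 1. ennreal (\<rho> ^ N))"
    by (intro sum_mono) auto
  also have "\<dots> = ennreal ((real M - 1) * \<rho> ^ N)"
    using M \<rho> by (simp add: ennreal_of_nat_eq_real_of_nat of_nat_diff flip: ennreal_mult)
  finally have sum_L: "(\<Sum>r<M - 1. emeasure T (L r)) \<le> ennreal ((real M - 1) * \<rho> ^ N)" .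
  have "{\<omega> \<in> space T. champ \<omega> (M - 1) \<noteq> i} \<subseteq> (\<Union>r<M - 1. L r)"
  proof
    fix \<omega> assume \<omega>: "\<omega> \<in> {\<omega> \<in> space T. champ \<omega> (M - 1) \<noteq> i}"
    show "\<omega> \<in> (\<Union>r<M - 1. L r)"
    proof (rule ccontr)
      assume "\<omega> \<notin> (\<Union>r<M - 1. L r)"
      then have win: "champ \<omega> (Suc r) = i" if "r < M - 1" "champ \<omega> r = i \<or> r + 2 = i" for r
        using that \<omega> unfolding L_def by blast
      have "champ \<omega> (M - 1) = i"
        by (rule champion_eqI[OF _ _ win]) (use i M in auto)
      with \<omega> show False by simp
    qed
  qed
  then have "emeasure T {\<omega> \<in> space T. champ \<omega> (M - 1) \<noteq> i} \<le> emeasure T (\<Union>r<M - 1. L r)"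
    by (intro emeasure_mono) auto
  also have "\<dots> \<le> (\<Sum>r<M - 1. emeasure T (L r))"
    by (intro emeasure_subadditive_finite) auto
  finally show ?thesis
    using sum_L by (simp add: T_def[symmetric] space_T)
qed

end

section \<open>The joint law of the unknown index and the trajectory\<close>

lemma prob_space_trajectory_law:
  assumes R: "R \<in> A \<rightarrow>\<^sub>M prob_algebra Y" and \<pi>: "policy A Y \<pi>"
  shows "prob_space (trajectory_law A Y R \<pi>)"
    and "sets (trajectory_law A Y R \<pi>) = sets (\<Pi>\<^sub>M t\<in>UNIV. A \<Otimes>\<^sub>M Y)"
proof -
  interpret IT: Ionescu_Tulcea "round_kernel A Y R \<pi>" "\<lambda>_. A \<Otimes>\<^sub>M Y"
    by (rule Ionescu_Tulcea_round_kernel[OF R \<pi>])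
  \<comment> \<open>The constant 1 depends on no coordinate, so the total mass is read off at
    horizon 0.\<close>
  have "emeasure IT.PF.lim (space IT.PF.lim) = (\<integral>\<^sup>+h. 1 \<partial>IT.C 0 0 (\<lambda>_. undefined))"
    using IT.nn_integral_lim_finite_horizon[of "\<lambda>_. 1" 0] by simp
  also have "\<dots> = 1"
    using prob_space.emeasure_space_1[OF IT.prob_space_C[of "\<lambda>_. undefined" 0 0]]
    by (simp add: space_PiM)
  finally show "prob_space (trajectory_law A Y R \<pi>)"
    unfolding trajectory_law_def by (rule prob_spaceI)
  show "sets (trajectory_law A Y R \<pi>) = sets (\<Pi>\<^sub>M t\<in>UNIV. A \<Otimes>\<^sub>M Y)"
    by (simp add: trajectory_law_def)
qed

lemma measurable_Pair_trajectory_law: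
  assumes R: "R \<in> A \<rightarrow>\<^sub>M prob_algebra Y" and \<pi>: "policy A Y \<pi>" and i: "i \<in> {1..M}"
  shows "Pair i \<in> trajectory_law A Y R \<pi> \<rightarrow>\<^sub>M run_space M A Y"
  unfolding run_space_def measurable_cong_sets[OF prob_space_trajectory_law(2)[OF R \<pi>] refl]
  using i by (intro measurable_Pair1') simp

lemma emeasure_run_law:
  assumes P: "\<And>i. i \<in> {1..M} \<Longrightarrow> P i \<in> A \<rightarrow>\<^sub>M prob_algebra Y" and \<pi>: "policy A Y \<pi>"
    and M: "1 \<le> M" and S: "S \<in> sets (run_space M A Y)"
  shows "emeasure (run_law M b A Y P \<pi>) S =
    (\<Sum>i\<in>{1..M}. ennreal (b i) *
      emeasure (trajectory_law A Y (P i) \<pi>) {\<omega> \<in> space (\<Pi>\<^sub>M t\<in>UNIV. A \<Otimes>\<^sub>M Y). (i, \<omega>) \<in> S})"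
proof -
  let ?B = "point_measure {1..M} (\<lambda>i. ennreal (b i))"
  let ?T = "\<lambda>i. trajectory_law A Y (P i) \<pi>"
  let ?k = "\<lambda>i. distr (?T i) (run_space M A Y) (Pair i)"
  note pair = measurable_Pair_trajectory_law[OF P \<pi>]
  have "?k i \<in> space (subprob_algebra (run_space M A Y))" if i: "i \<in> {1..M}" for i
    using prob_space.prob_space_distr[OF prob_space_trajectory_law(1)[OF P[OF i] \<pi>] pair[OF i i]]
    by (simp add: space_subprob_algebra prob_space_imp_subprob_space)
  then have k: "?k \<in> ?B \<rightarrow>\<^sub>M subprob_algebra (run_space M A Y)"
    by (simp add: measurable_point_measure_eq1)
  have "emeasure (run_law M b A Y P \<pi>) S = (\<integral>\<^sup>+i. emeasure (?k i) S \<partial>?B)"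
    unfolding run_law_def using M by (intro emeasure_bind[OF _ k S]) (simp add: space_point_measure)
  also have "\<dots> = (\<Sum>i\<in>{1..M}. ennreal (b i) * emeasure (?k i) S)"
    by (rule nn_integral_point_measure_finite) simp
  also have "\<dots> = (\<Sum>i\<in>{1..M}. ennreal (b i) *
      emeasure (?T i) {\<omega> \<in> space (\<Pi>\<^sub>M t\<in>UNIV. A \<Otimes>\<^sub>M Y). (i, \<omega>) \<in> S})"
  proof (rule sum.cong[OF refl])
    fix i assume i: "i \<in> {1..M}"
    have "Pair i -` S \<inter> space (?T i) = {\<omega> \<in> space (\<Pi>\<^sub>M t\<in>UNIV. A \<Otimes>\<^sub>M Y). (i, \<omega>) \<in> S}"
      using sets_eq_imp_space_eq[OF prob_space_trajectory_law(2)[OF P[OF i] \<pi>]] by auto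
    then show "ennreal (b i) * emeasure (?k i) S = ennreal (b i) *
        emeasure (?T i) {\<omega> \<in> space (\<Pi>\<^sub>M t\<in>UNIV. A \<Otimes>\<^sub>M Y). (i, \<omega>) \<in> S}"
      by (simp add: emeasure_distr[OF pair[OF i i] S])
  qed
  finally show ?thesis .
qed

context tournament
begin

lemma champ_in_range: "1 \<le> M \<Longrightarrow> champ h (M - 1) \<in> {1..M}"
  using champion_ge_1[of v N h "M - 1"] champion_le[of v N h "M - 1"] by auto

text \<open>The run has fixed length, so stopping and finiteness are immediate. What needs an
  argument is the estimate: the champion after \<open>M - 1\<close> blocks reads only the first
  \<open>(M - 1) * N\<close> rounds, and never the unknown index.\<close>

lemma admissible_king:
  assumes M: "1 \<le> M" and B: "B \<in> sets A" "\<And>c d. probe c d \<in> B"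
  shows "admissible_procedure M b A Y P B king_policy (\<lambda>_. enat ((M - 1) * N)) (\<lambda>(i, \<omega>). champ \<omega> (M - 1))"
  unfolding admissible_procedure_def
proof (intro conjI)
  let ?T = "enat ((M - 1) * N)"
  let ?F = "history_filtration M A Y"
  let ?S = "space (run_space M A Y)"
  have "AE a in king_policy t h. a \<in> B" for t h
    unfolding king_policy_def using B sets.Int_space_eq2[OF B(1)] play_space[of t h]
    by (subst AE_return) (auto simp: play_def pred_def)
  then show "supported_policy A Y B king_policy"
    unfolding supported_policy_def using policy_king by blast
  show stop: "stopping_time ?F (\<lambda>_. ?T)"
    by (rule stopping_time_const)
  interpret filtration ?S ?F
    by (rule filtration_history_filtration)
  have r: "(\<lambda>(i, \<omega>). restrict \<omega> {s. enat s < ?T}) \<in> ?F ?T \<rightarrow>\<^sub>M (\<Pi>\<^sub>M s\<in>{s. enat s < ?T}. A \<Otimes>\<^sub>M Y)"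
    unfolding history_filtration_def
    by (rule measurable_vimage_algebra1)
      (auto simp: run_space_def space_pair_measure space_PiM PiE_iff split: if_splits)
  have c: "(\<lambda>h. champ h (M - 1)) \<in> (\<Pi>\<^sub>M s\<in>{s. enat s < ?T}. A \<Otimes>\<^sub>M Y) \<rightarrow>\<^sub>M count_space UNIV"
    by (rule measurable_champion[OF v]) auto
  have "champ (restrict \<omega> {s. enat s < ?T}) (M - 1) = champ \<omega> (M - 1)" for \<omega>
    by (rule champion_cong) simp
  with measurable_compose[OF r c]
  have I: "(\<lambda>(i, \<omega>). champ \<omega> (M - 1)) \<in> ?F ?T \<rightarrow>\<^sub>M count_space UNIV"
    by (simp add: split_beta')
  show "(\<lambda>(i, \<omega>). champ \<omega> (M - 1)) \<in> pre_sigma (\<lambda>_. ?T) \<rightarrow>\<^sub>M count_space {1..M}"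
  proof (subst measurable_count_space_eq2, simp, intro conjI ballI)
    show "(\<lambda>(i, \<omega>). champ \<omega> (M - 1)) \<in> space (pre_sigma (\<lambda>_. ?T)) \<rightarrow> {1..M}"
      using champ_in_range[OF M] by auto
    fix c
    let ?C = "(\<lambda>(i, \<omega>). champ \<omega> (M - 1)) -` {c} \<inter> space (pre_sigma (\<lambda>_. ?T))"
    have C: "?C \<in> sets (?F ?T)"
      using measurable_sets[OF I, of "{c}"] by (simp add: space_pre_sigma space_F)
    \<comment> \<open>For a constant time the part of \<open>?C\<close> stopped by \<open>t\<close>
      is either all of \<open>?C\<close>, known at \<open>?T\<close> and hence at \<open>t\<close>,
      or empty.\<close>
    show "?C \<in> sets (pre_sigma (\<lambda>_. ?T))"
    proof (rule sets_pre_sigmaI[OF stop])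
      fix t
      show "{\<omega> \<in> ?C. ?T \<le> t} \<in> sets (?F t)"
      proof (cases "?T \<le> t")
        case True
        then have "{\<omega> \<in> ?C. ?T \<le> t} = ?C" by blast
        then show ?thesis using C sets_F_mono[OF True] by (simp only: subsetD)
      next
        case False
        then have "{\<omega> \<in> ?C. ?T \<le> t} = {}" by blast
        then show ?thesis by (simp only: sets.empty_sets)
      qed
    qed
  qed
qed simp

text \<open>The bound of \<open>champ_error\<close> is the same for every index, so averaging it
  over the prior changes nothing.\<close>

lemma error_king:
  assumes M: "2 \<le> M" and b: "\<And>i. i \<in> {1..M} \<Longrightarrow> 0 \<le> b i" "(\<Sum>i\<in>{1..M}. b i) = 1"
  shows "error_probability M b A Y P king_policy (\<lambda>(i, \<omega>). champ \<omega> (M - 1)) \<le> (real M - 1) * \<rho> ^ N"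
proof -
  let ?S = "{x \<in> space (run_space M A Y). (\<lambda>(i, \<omega>). champ \<omega> (M - 1)) x \<noteq> fst x}"
  have "(\<lambda>h. champ h (M - 1)) \<in> (\<Pi>\<^sub>M s\<in>UNIV. A \<Otimes>\<^sub>M Y) \<rightarrow>\<^sub>M count_space UNIV"
    by (rule measurable_champion[OF v]) simp
  from measurable_compose[OF measurable_snd this]
  have c: "(\<lambda>x. champ (snd x) (M - 1)) \<in> run_space M A Y \<rightarrow>\<^sub>M count_space UNIV"
    unfolding run_space_def .
  have f: "fst \<in> run_space M A Y \<rightarrow>\<^sub>M count_space UNIV"
    unfolding run_space_def
    by (rule measurable_compose[OF measurable_fst, where g="\<lambda>i. i" and L="count_space UNIV"]) simp
  have "Measurable.pred (run_space M A Y) (\<lambda>x. champ (snd x) (M - 1) \<noteq> fst x)"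
  proof (rule measurable_compose_countable[OF _ f])
    show "Measurable.pred (run_space M A Y) (\<lambda>x. champ (snd x) (M - 1) \<noteq> i)" for i
      by (rule measurable_compose[OF c]) simp
  qed
  then have S: "?S \<in> sets (run_space M A Y)"
    by (simp add: pred_def split_beta')
  have \<rho>N: "0 \<le> (real M - 1) * \<rho> ^ N" using M \<rho> by simp
  have "emeasure (run_law M b A Y P king_policy) ?S = (\<Sum>i\<in>{1..M}. ennreal (b i) *
      emeasure (trajectory_law A Y (P i) king_policy) {\<omega> \<in> space (\<Pi>\<^sub>M t\<in>UNIV. A \<Otimes>\<^sub>M Y). (i, \<omega>) \<in> ?S})"
    using M by (intro emeasure_run_law P policy_king S) auto
  also have "\<dots> \<le> (\<Sum>i\<in>{1..M}. ennreal (b i) * ennreal ((real M - 1) * \<rho> ^ N))"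
  proof (intro sum_mono mult_left_mono)
    fix i assume i: "i \<in> {1..M}"
    then have "{\<omega> \<in> space (\<Pi>\<^sub>M t\<in>UNIV. A \<Otimes>\<^sub>M Y). (i, \<omega>) \<in> ?S} =
        {\<omega> \<in> space (\<Pi>\<^sub>M t\<in>UNIV. A \<Otimes>\<^sub>M Y). champ \<omega> (M - 1) \<noteq> i}"
      by (auto simp: run_space_def space_pair_measure)
    then show "emeasure (trajectory_law A Y (P i) king_policy) {\<omega> \<in> space (\<Pi>\<^sub>M t\<in>UNIV. A \<Otimes>\<^sub>M Y). (i, \<omega>) \<in> ?S}
        \<le> ennreal ((real M - 1) * \<rho> ^ N)"
      using champ_error[OF i M] by simp
  qed simp
  also have "\<dots> = ennreal ((real M - 1) * \<rho> ^ N)"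
  proof -
    have "(\<Sum>i\<in>{1..M}. ennreal (b i)) = 1" using b by (subst sum_ennreal) auto
    then show ?thesis by (simp only: sum_distrib_right[symmetric] mult_1)
  qed
  finally show ?thesis
    unfolding error_probability_def measure_def by (intro enn2real_leI \<rho>N)
qed

lemma inner_value_le:
  assumes M: "2 \<le> M" and b: "\<And>i. i \<in> {1..M} \<Longrightarrow> 0 \<le> b i" "(\<Sum>i\<in>{1..M}. b i) = 1"
    and B: "B \<in> sets A" "\<And>c d. probe c d \<in> B" and \<delta>: "(real M - 1) * \<rho> ^ N \<le> \<delta>"
  shows "inner_value \<delta> M b A Y P B \<le> of_nat ((M - 1) * N)"
proof -
  let ?I = "\<lambda>(i :: nat, \<omega>). champ \<omega> (M - 1)" and ?\<tau> = "\<lambda>_ :: nat \<times> (nat \<Rightarrow> 'a \<times> 'y). enat ((M - 1) * N)"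
  interpret prob_space "run_law M b A Y P king_policy"
    by (rule prob_space_run_law(1)[OF P policy_king b])
  have "(king_policy, ?\<tau>, ?I) \<in> {(\<pi>, \<tau>, Ihat). admissible_procedure M b A Y P B \<pi> \<tau> Ihat \<and>
      error_probability M b A Y P \<pi> Ihat \<le> \<delta>}"
    using admissible_king[OF _ B, of b] error_king[OF M b] \<delta> M by auto
  then have "inner_value \<delta> M b A Y P B \<le>
      (\<integral>\<^sup>+x. ennreal_of_enat (?\<tau> x) \<partial>run_law M b A Y P king_policy)"
    unfolding inner_value_def by (rule INF_lower2) simp
  also have "\<dots> = of_nat ((M - 1) * N)"
    by (simp add: emeasure_space_1)
  finally show ?thesis .
qed

end


section \<open>Scores of summaries\<close>

lemma measure_finite_space_sum:
  assumes "prob_space p" "sets p = sets (count_space {1..K::nat})"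
  shows "(\<Sum>k\<in>{1..K}. measure p {k}) = 1"
proof -
  interpret prob_space p by fact
  have "space p = {1..K}" using sets_eq_imp_space_eq[OF assms(2)] by simp
  then show ?thesis
    using finite_measure_eq_sum_singleton[of "{1..K}"] assms(2) prob_space by auto
qed

lemma integral_finite_space:
  fixes f :: "nat \<Rightarrow> real"
  assumes "prob_space p" "sets p = sets (count_space {1..K})"
  shows "integral\<^sup>L p f = (\<Sum>k\<in>{1..K}. f k * measure p {k})"
proof -
  interpret prob_space p by fact
  have sp: "space p = {1..K}" using sets_eq_imp_space_eq[OF assms(2)] by simp
  have sg: "{k} \<in> sets p" if "k \<in> {1..K}" for k using assms(2) that by simp
  have "integral\<^sup>L p f = (\<integral>x. (\<Sum>k\<in>{1..K}. f k * indicator {k} x) \<partial>p)"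
    using sp by (intro Bochner_Integration.integral_cong refl) (simp add: indicator_def if_distrib cong: if_cong)
  also have "\<dots> = (\<Sum>k\<in>{1..K}. \<integral>x. f k * indicator {k} x \<partial>p)"
    using sg by (intro Bochner_Integration.integral_sum integrable_mult_right integrable_real_indicator)
      (auto simp: less_top[symmetric])
  also have "\<dots> = (\<Sum>k\<in>{1..K}. f k * measure p {k})"
    using sg sp by (intro sum.cong refl) (simp add: Int_absorb2)
  finally show ?thesis .
qed

text \<open>The centring makes the score antisymmetric in \<open>p\<close> and \<open>q\<close>, so that one statistic handles an
  error of either side of a comparison.\<close>

definition score :: "nat \<Rightarrow> nat measure \<Rightarrow> nat measure \<Rightarrow> nat \<Rightarrow> real" where
  "score K p q k = sgn (measure p {k} - measure q {k}) -
     (\<Sum>j\<in>{1..K}. sgn (measure p {j} - measure q {j}) * (measure p {j} + measure q {j})) / 2"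

lemma score_swap: "score K q p k = - score K p q k"
proof -
  have "sgn (measure q {j} - measure p {j}) = - sgn (measure p {j} - measure q {j})" for j
    by (simp add: sgn_minus[symmetric])
  then show ?thesis
    by (simp add: score_def sum_negf[symmetric] add.commute)
qed

lemma l1_dist_commute: "l1_dist K p q = l1_dist K q p"
  by (simp add: l1_dist_def abs_minus_commute)

text \<open>The centring constant is the midpoint of the means of the sign statistic under
  \<open>p\<close> and \<open>q\<close>. Those means differ by the distance of the two laws, so the
  mean under \<open>p\<close> lies half of it above the midpoint.\<close>

lemma expectation_score:
  assumes p: "prob_space p" "sets p = sets (count_space {1..K})"
  shows "integral\<^sup>L p (score K p q) = l1_dist K p q / 2"
proof -
  let ?s = "\<lambda>k. sgn (measure p {k} - measure q {k})"
  let ?c = "\<Sum>j\<in>{1..K}. ?s j * (measure p {j} + measure q {j})"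
  have "integral\<^sup>L p (score K p q) = (\<Sum>k\<in>{1..K}. ?s k * measure p {k}) - ?c / 2 * (\<Sum>k\<in>{1..K}. measure p {k})"
    by (simp only: integral_finite_space[OF p] score_def left_diff_distrib sum_subtractf sum_distrib_left[symmetric])
  also have "\<dots> = (\<Sum>k\<in>{1..K}. ?s k * measure p {k}) - ?c / 2"
    by (simp only: measure_finite_space_sum[OF p] mult_1_right)
  also have "\<dots> = (\<Sum>k\<in>{1..K}. (measure p {k} - measure q {k}) * ?s k) / 2"
    by (simp add: sum_divide_distrib sum_subtractf[symmetric] field_simps)
  also have "\<dots> = l1_dist K p q / 2"
    unfolding l1_dist_def by (simp add: abs_sgn)
  finally show ?thesis .
qed

text \<open>At tilt \<eta> / 2 the mean contributes at most - \<eta>^2 / 4 to the exponent and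
  Hoeffding's lemma, for an interval of length 2, adds \<eta>^2 / 8.\<close>

lemma nn_integral_exp_score_le:
  assumes p: "prob_space p" "sets p = sets (count_space {1..K})"
    and \<eta>: "0 < \<eta>" "\<eta> \<le> l1_dist K p q"
  shows "(\<integral>\<^sup>+k. ennreal (exp (- (\<eta> / 2) * score K p q k)) \<partial>p) \<le> ennreal (exp (- \<eta>\<^sup>2 / 8))"
proof -
  define c where "c = (\<Sum>j\<in>{1..K}. sgn (measure p {j} - measure q {j}) * (measure p {j} + measure q {j})) / 2"
  have meas: "f \<in> borel_measurable p" for f :: "nat \<Rightarrow> real"
    by (subst measurable_cong_sets[OF p(2) refl]) simp
  interpret prob_space p by fact
  \<comment> \<open>The centring only shifts the interval; Hoeffding's lemma sees its length alone,
    so no bound on \<open>c\<close> is required.\<close>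
  interpret interval_bounded_random_variable p "\<lambda>k. - score K p q k" "c - 1" "c + 1"
  proof
    show "AE k in p. - score K p q k \<in> {c - 1..c + 1}"
    proof (rule AE_I2)
      fix k
      have "score K p q k = sgn (measure p {k} - measure q {k}) - c"
        by (simp only: score_def c_def)
      then show "- score K p q k \<in> {c - 1..c + 1}"
        by (simp add: sgn_if)
    qed
  qed (rule meas)
  let ?E = "expectation (\<lambda>k. - score K p q k)"
  have E: "?E \<le> - \<eta> / 2"
    using \<eta> expectation_score[OF p, of q] by simp
  have "(\<integral>\<^sup>+k. ennreal (exp (- (\<eta> / 2) * score K p q k)) \<partial>p) =
      (\<integral>\<^sup>+k. ennreal (exp (\<eta> / 2 * ?E)) * ennreal (exp (\<eta> / 2 * (- score K p q k - ?E))) \<partial>p)"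
    by (intro nn_integral_cong) (simp add: algebra_simps exp_add[symmetric] flip: ennreal_mult)
  also have "\<dots> = ennreal (exp (\<eta> / 2 * ?E)) * (\<integral>\<^sup>+k. ennreal (exp (\<eta> / 2 * (- score K p q k - ?E))) \<partial>p)"
    by (intro nn_integral_cmult measurable_compose[OF meas measurable_ennreal])
  also have "\<dots> \<le> ennreal (exp (\<eta> / 2 * ?E)) * ennreal (exp ((\<eta> / 2)\<^sup>2 * (c + 1 - (c - 1))\<^sup>2 / 8))"
    using \<eta> by (intro mult_left_mono Hoeffdings_lemma_nn_integral) auto
  also have "\<dots> = ennreal (exp (\<eta> / 2 * ?E + \<eta>\<^sup>2 / 8))"
    by (simp add: power_divide exp_add[symmetric] flip: ennreal_mult)
  also have "\<dots> \<le> ennreal (exp (- \<eta>\<^sup>2 / 8))"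
  proof -
    have "\<eta> / 2 * ?E \<le> \<eta> / 2 * (- \<eta> / 2)"
      using E \<eta> by (intro mult_left_mono) auto
    then have "\<eta> / 2 * ?E + \<eta>\<^sup>2 / 8 \<le> - \<eta>\<^sup>2 / 8"
      by (simp add: power2_eq_square)
    then show ?thesis by (intro ennreal_leI) (simp only: exp_le_cancel_iff)
  qed
  finally show ?thesis .
qed

section \<open>Separating designs\<close>

lemma finite_pairs: "finite (pairs M)"
  by (rule finite_subset[of _ "{1..M} \<times> {1..M}"]) (auto simp: pairs_def)

lemma pairs_nonempty:
  assumes "2 \<le> M"
  shows "pairs M \<noteq> {}"
proof -
  have "(1, 2) \<in> pairs M" using assms by (simp add: pairs_def)
  then show ?thesis by blast
qed

lemma module_sep_ge_iff:
  assumes "finite (\<A> u)" "\<A> u \<noteq> {}"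
  shows "\<eta> \<le> module_sep K Q \<A> u (i, j) \<longleftrightarrow> (\<exists>a\<in>\<A> u. \<eta> \<le> l1_dist K (Q i a) (Q j a))"
  using assms by (simp add: module_sep_def Max_ge_iff)

text \<open>The threshold is positive, so the empty design, whose separation is 0 by convention,
  fails just as an empty union does; \<open>2 \<le> M\<close> keeps the outer minimum over a
  nonempty set.\<close>

lemma separating_iff_cover:
  assumes M: "2 \<le> M" and S: "finite S" and \<eta>: "0 < \<eta>"
  shows "separating M K Q \<A> \<eta> S \<longleftrightarrow> (\<Union>u\<in>S. cover_sets M K Q \<A> \<eta> u) = pairs M"
proof -
  have "separating M K Q \<A> \<eta> S \<longleftrightarrow> (\<forall>ij\<in>pairs M. \<exists>u\<in>S. \<eta> \<le> module_sep K Q \<A> u ij)"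
    using S \<eta> finite_pairs[of M] pairs_nonempty[OF M]
    by (auto simp: separating_def design_sep_def Max_ge_iff)
  also have "\<dots> \<longleftrightarrow> (\<Union>u\<in>S. cover_sets M K Q \<A> \<eta> u) = pairs M"
    by (auto simp: cover_sets_def)
  finally show ?thesis .
qed

lemma inner_value_separating_le:
  assumes M: "2 \<le> M" and P: "\<And>i. i \<in> {1..M} \<Longrightarrow> P i \<in> A \<rightarrow>\<^sub>M prob_algebra Y"
    and b: "\<And>i. i \<in> {1..M} \<Longrightarrow> 0 \<le> b i" "(\<Sum>i\<in>{1..M}. b i) = 1"
    and S: "finite S" "\<And>u. u \<in> S \<Longrightarrow> finite (\<A> u) \<and> \<A> u \<noteq> {} \<and> \<A> u \<in> sets A"
    and \<phi>: "\<And>a. a \<in> space A \<Longrightarrow> \<phi> a \<in> Y \<rightarrow>\<^sub>M count_space {1..K}"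
    and \<eta>: "0 < \<eta>" and \<delta>: "0 < \<delta>" "\<delta> < 1"
    and sep: "separating M K (summary_law K P \<phi>) \<A> \<eta> S"
  shows "inner_value \<delta> M b A Y P (\<Union>u\<in>S. \<A> u)
    \<le> ennreal ((real M - 1) * real_of_int \<lceil>8 / \<eta>\<^sup>2 * ln ((real M - 1) / \<delta>)\<rceil>)"
proof -
  let ?Q = "summary_law K P \<phi>" and ?B = "\<Union>u\<in>S. \<A> u"
  \<comment> \<open>The least \<open>N\<close> with
    \<open>(M - 1) * exp (- N * \<eta>\<^sup>2 / 8) \<le> \<delta>\<close>, the error bound of the
    tournament. Since \<open>M - 1\<close> exceeds \<delta>, the logarithm is positive and
    \<open>nat\<close> loses nothing.\<close>
  define N where "N = nat \<lceil>8 / \<eta>\<^sup>2 * ln ((real M - 1) / \<delta>)\<rceil>"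
  have ratio: "1 < (real M - 1) / \<delta>"
    using M \<delta> by (simp add: field_simps)
  then have pos: "0 < 8 / \<eta>\<^sup>2 * ln ((real M - 1) / \<delta>)"
    using \<eta> by (intro mult_pos_pos) auto
  then have N_bounds: "0 < N" "8 / \<eta>\<^sup>2 * ln ((real M - 1) / \<delta>) \<le> real N"
    "real N = real_of_int \<lceil>8 / \<eta>\<^sup>2 * ln ((real M - 1) / \<delta>)\<rceil>"
    unfolding N_def by (auto simp: less_ceiling_iff intro: real_nat_ceiling_ge)
  have B: "?B \<in> sets A" using S by auto
  \<comment> \<open>For a pair outside the range the implication is void and any available
    evaluation will do; one exists because a separating design is nonempty. This makes the probe
    total.\<close>
  have ex: "\<exists>a\<in>?B. 1 \<le> c \<and> c < d \<and> d \<le> M \<longrightarrow> \<eta> \<le> l1_dist K (?Q c a) (?Q d a)" for c d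
  proof (cases "(c, d) \<in> pairs M")
    case True
    then obtain u where "u \<in> S" "(c, d) \<in> cover_sets M K ?Q \<A> \<eta> u"
      using sep separating_iff_cover[OF M S(1) \<eta>] by blast
    then show ?thesis
      using S(2)[of u] module_sep_ge_iff[of \<A> u \<eta> K ?Q c d] by (auto simp: cover_sets_def)
  next
    case False
    have "S \<noteq> {}"
      using sep separating_iff_cover[OF M S(1) \<eta>] pairs_nonempty[OF M] by auto
    with S(2) have "?B \<noteq> {}" by blast
    then show ?thesis using False by (auto simp: pairs_def)
  qed
  define good where "good c d a \<longleftrightarrow> a \<in> ?B \<and>
      (1 \<le> c \<and> c < d \<and> d \<le> M \<longrightarrow> \<eta> \<le> l1_dist K (?Q c a) (?Q d a))" for c d a
  define probe where "probe c d = (SOME a. good c d a)" for c d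
  have "\<exists>a. good c d a" for c d
    using ex[of c d] unfolding good_def by blast
  then have "good c d (probe c d)" for c d
    unfolding probe_def by (rule someI_ex)
  then have probe_B: "\<And>c d. probe c d \<in> ?B"
    and probe_sep: "\<And>c d. 1 \<le> c \<Longrightarrow> c < d \<Longrightarrow> d \<le> M \<Longrightarrow>
      \<eta> \<le> l1_dist K (?Q c (probe c d)) (?Q d (probe c d))"
    unfolding good_def by blast+
  have probe_space: "probe c d \<in> space A" for c d
    using sets.sets_into_space[OF B] probe_B by blast
  define v where "v c d y =
      score K (?Q c (probe c d)) (?Q d (probe c d)) (\<phi> (probe c d) y)" for c d y
  have v: "v c d \<in> borel_measurable Y" for c d
    unfolding v_def by (rule measurable_compose[OF \<phi>[OF probe_space]]) simp
  have law: "(\<integral>\<^sup>+y. f (\<phi> a y) \<partial>P i a) = (\<integral>\<^sup>+k. f k \<partial>?Q i a)"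
    "prob_space (?Q i a)" "sets (?Q i a) = sets (count_space {1..K})"
    if "i \<in> {1..M}" "a \<in> space A" for i a and f :: "nat \<Rightarrow> ennreal"
  proof -
    have Pa: "prob_space (P i a)" "sets (P i a) = sets Y"
      using measurable_space[OF P[OF that(1)] that(2)] by (auto simp: space_prob_algebra)
    have m: "\<phi> a \<in> P i a \<rightarrow>\<^sub>M count_space {1..K}"
      unfolding measurable_cong_sets[OF Pa(2) refl] by (rule \<phi>[OF that(2)])
    show "(\<integral>\<^sup>+y. f (\<phi> a y) \<partial>P i a) = (\<integral>\<^sup>+k. f k \<partial>?Q i a)"
      unfolding summary_law_def by (subst nn_integral_distr[OF m]) auto
    show "prob_space (?Q i a)"
      unfolding summary_law_def by (rule prob_space.prob_space_distr[OF Pa(1) m])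
    show "sets (?Q i a) = sets (count_space {1..K})"
      by (simp add: summary_law_def)
  qed
  interpret tournament M N A Y P probe v "\<eta> / 2" "exp (- \<eta>\<^sup>2 / 8)"
  proof
    fix c d assume cd: "1 \<le> c" "c < d" "d \<le> M"
    let ?p = "?Q c (probe c d)" and ?q = "?Q d (probe c d)"
    have c: "c \<in> {1..M}" and d: "d \<in> {1..M}" using cd by auto
    show "(\<integral>\<^sup>+y. ennreal (exp (- (\<eta> / 2) * v c d y)) \<partial>P c (probe c d)) \<le> ennreal (exp (- \<eta>\<^sup>2 / 8))"
      unfolding v_def
      by (subst law(1)[OF c probe_space, where f="\<lambda>k. ennreal (exp (- (\<eta> / 2) * score K ?p ?q k))"])
        (intro nn_integral_exp_score_le law[OF c probe_space] \<eta> probe_sep[OF cd])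
    \<comment> \<open>For the challenger the true law and the sign of the score change together, so
      the same bound applies with the two laws exchanged.\<close>
    have "\<eta> / 2 * v c d y = - (\<eta> / 2) * score K ?q ?p (\<phi> (probe c d) y)" for y
      unfolding v_def by (subst score_swap) simp
    then show "(\<integral>\<^sup>+y. ennreal (exp (\<eta> / 2 * v c d y)) \<partial>P d (probe c d)) \<le> ennreal (exp (- \<eta>\<^sup>2 / 8))"
      using nn_integral_exp_score_le[OF law(2,3)[OF d probe_space] \<eta>, where q="?p"] probe_sep[OF cd]
      by (simp only: law(1)[OF d probe_space, where f="\<lambda>k. ennreal (exp (- (\<eta> / 2) * score K ?q ?p k))"]
          l1_dist_commute[of K ?q ?p])
  qed (use N_bounds(1) P probe_space v \<eta> in auto)
  have "(real M - 1) * exp (- \<eta>\<^sup>2 / 8) ^ N \<le> \<delta>"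
  proof -
    have "ln ((real M - 1) / \<delta>) \<le> real N * (\<eta>\<^sup>2 / 8)"
      using N_bounds(2) \<eta> by (simp add: field_simps)
    then have "exp (- (real N * (\<eta>\<^sup>2 / 8))) \<le> exp (- ln ((real M - 1) / \<delta>))" by simp
    also have "\<dots> = \<delta> / (real M - 1)"
      using ratio by (simp add: exp_minus)
    finally have "exp (- \<eta>\<^sup>2 / 8) ^ N \<le> \<delta> / (real M - 1)"
      by (simp add: exp_of_nat_mult[symmetric])
    then show ?thesis using M by (simp add: field_simps)
  qed
  from inner_value_le[OF M b B probe_B this]
  have "inner_value \<delta> M b A Y P ?B \<le> of_nat ((M - 1) * N)" .
  also have "\<dots> = ennreal ((real M - 1) * real N)"
    using M by (simp add: ennreal_of_nat_eq_real_of_nat of_nat_diff)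
  finally show ?thesis unfolding N_bounds(3) .
qed

section \<open>Calibration\<close>

lemma measure_empirical_law:
  assumes "\<And>l. l < n \<Longrightarrow> x l \<in> {1..K}" "k \<in> {1..K}"
  shows "measure (empirical_law K n x) {k} = (\<Sum>l<n. if x l = k then 1 else 0) / real n"
proof -
  have "measure (empirical_law K n x) {k} = measure (uniform_count_measure {..<n}) (x -` {k} \<inter> {..<n})"
    unfolding empirical_law_def using assms
    by (subst measure_distr)
      (auto simp: measurable_def sets_uniform_count_measure space_uniform_count_measure)
  also have "\<dots> = real (card (x -` {k} \<inter> {..<n})) / real n"
    by (subst measure_uniform_count_measure) auto
  also have "real (card (x -` {k} \<inter> {..<n})) = (\<Sum>l<n. if x l = k then 1 else 0)"
    by (simp add: sum.If_cases vimage_def Int_commute)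
  finally show ?thesis .
qed

lemma sum_empirical_law:
  assumes x: "\<And>l. l < n \<Longrightarrow> x l \<in> {1..K}"
  shows "(\<Sum>k\<in>{1..K}. f k * measure (empirical_law K n x) {k}) = (\<Sum>l<n. f (x l)) / real n"
proof -
  have "(\<Sum>k\<in>{1..K}. f k * measure (empirical_law K n x) {k}) =
      (\<Sum>k\<in>{1..K}. \<Sum>l<n. (if x l = k then f k else 0)) / real n"
    unfolding sum_divide_distrib[of _ "{1..K}"]
  proof (rule sum.cong[OF refl])
    fix k assume "k \<in> {1..K}"
    then have "f k * measure (empirical_law K n x) {k} = (\<Sum>l<n. f k * (if x l = k then 1 else 0)) / real n"
      using x by (simp only: measure_empirical_law times_divide_eq_right sum_distrib_left)
    also have "(\<Sum>l<n. f k * (if x l = k then 1 else 0)) = (\<Sum>l<n. if x l = k then f k else 0)"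
      by (intro sum.cong refl) simp
    finally show "f k * measure (empirical_law K n x) {k} = (\<Sum>l<n. if x l = k then f k else 0) / real n" .
  qed
  also have "\<dots> = (\<Sum>l<n. \<Sum>k\<in>{1..K}. if x l = k then f k else 0) / real n"
    by (subst sum.swap) (rule refl)
  also have "\<dots> = (\<Sum>l<n. f (x l)) / real n"
    using x by (intro arg_cong2[where f="(/)"] sum.cong refl) (auto simp: sum.delta')
  finally show ?thesis .
qed

lemma borel_measurable_empirical_law:
  assumes X: "\<And>l. l < n \<Longrightarrow> X l \<in> \<Omega> \<rightarrow>\<^sub>M count_space {1..K}" and k: "k \<in> {1..K}"
  shows "(\<lambda>\<omega>. measure (empirical_law K n (\<lambda>l. X l \<omega>)) {k}) \<in> borel_measurable \<Omega>"
proof -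
  have "(\<lambda>\<omega>. (\<Sum>l<n. if X l \<omega> = k then 1 else 0) / real n) \<in> borel_measurable \<Omega>"
  proof (intro borel_measurable_divide borel_measurable_sum)
    fix l assume "l \<in> {..<n}"
    then have "X l \<in> \<Omega> \<rightarrow>\<^sub>M count_space {1..K}" using X by simp
    from measurable_compose[OF this, of "\<lambda>x. if x = k then 1 else 0" borel]
    show "(\<lambda>\<omega>. if X l \<omega> = k then 1 else 0 :: real) \<in> borel_measurable \<Omega>" by simp
  qed simp
  moreover have "measure (empirical_law K n (\<lambda>l. X l \<omega>)) {k} = (\<Sum>l<n. if X l \<omega> = k then 1 else 0) / real n"
    if "\<omega> \<in> space \<Omega>" for \<omega>
    using measurable_space[OF X that] k by (intro measure_empirical_law) auto
  ultimately show ?thesis by (simp cong: measurable_cong)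
qed

text \<open>The draws for \<open>i\<close> enter with sign + and those for \<open>j\<close> with
  sign -, which gives \<open>2 * n\<close> independent terms in [-1, 1] with squared widths adding
  up to \<open>8 * n\<close>. A deviation \<epsilon> of the signed sum is a deviation
  \<open>n * \<epsilon>\<close> of the total, and Hoeffding's exponent is - 2 * (n * \<epsilon>)^2 /
  (8 * n) = - n * \<epsilon>^2 / 4.\<close>

lemma (in prob_space) signed_deviation_bound:
  fixes X :: "nat \<Rightarrow> 'b \<Rightarrow> nat \<Rightarrow> 'a \<Rightarrow> nat" and \<epsilon> :: real and s :: "nat \<Rightarrow> real"
  assumes ij: "i \<noteq> j" and n: "0 < n" and \<epsilon>: "0 \<le> \<epsilon>"
    and indep: "indep_vars (\<lambda>_. count_space {1..K}) (\<lambda>(i, a, l). X i a l) ({i, j} \<times> {a} \<times> {..<n})"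
    and laws: "\<And>c l. c \<in> {i, j} \<Longrightarrow> l < n \<Longrightarrow> distr M (count_space {1..K}) (X c a l) = Q c"
    and s: "\<And>k. \<bar>s k\<bar> \<le> 1"
  defines "F \<equiv> \<lambda>c \<omega>. empirical_law K n (\<lambda>l. X c a l \<omega>)"
  shows "prob {\<omega> \<in> space M. \<epsilon> \<le> (\<Sum>k\<in>{1..K}. s k *
      ((measure (F i \<omega>) {k} - measure (F j \<omega>) {k}) - (measure (Q i) {k} - measure (Q j) {k})))}
    \<le> exp (- real n * \<epsilon>\<^sup>2 / 4)"
proof -
  let ?I = "{i, j} \<times> {a} \<times> {..<n}"
  let ?V = "\<lambda>(c, a, l) \<omega>. (if c = i then 1 else -1) * s (X c a l \<omega>)"
  have rv: "X c a l \<in> M \<rightarrow>\<^sub>M count_space {1..K}" if "c \<in> {i, j}" "l < n" for c l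
    using indep that unfolding indep_vars_def by auto
  have expect: "expectation (\<lambda>\<omega>. s (X c a l \<omega>)) = (\<Sum>k\<in>{1..K}. s k * measure (Q c) {k})"
    if "c \<in> {i, j}" "l < n" for c l
  proof -
    have "expectation (\<lambda>\<omega>. s (X c a l \<omega>)) = integral\<^sup>L (distr M (count_space {1..K}) (X c a l)) s"
      using rv[OF that] by (subst integral_distr) auto
    also have "\<dots> = (\<Sum>k\<in>{1..K}. s k * measure (Q c) {k})"
      using prob_space_distr[OF rv[OF that]] laws[OF that, symmetric]
      by (simp only: integral_finite_space sets_distr)
    finally show ?thesis .
  qed
  interpret H: Hoeffding_ineq M ?I ?V "\<lambda>_. - 1" "\<lambda>_. 1" "\<Sum>d\<in>?I. expectation (?V d)"
  proof unfold_locales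
    show "indep_vars (\<lambda>_. borel) ?V ?I"
      using indep_vars_compose2[OF indep, of "\<lambda>(c, a, l) x. (if c = i then 1 else -1) * s x" "\<lambda>_. borel"]
      by (simp add: split_beta')
    show "AE \<omega> in M. ?V d \<omega> \<in> {- 1..1}" if "d \<in> ?I" for d
      using s by (intro AE_I2) (auto simp: abs_le_iff split: prod.splits; metis minus_le_iff)
  qed auto
  have sum_I: "(\<Sum>d\<in>?I. g d) = (\<Sum>l<n. g (i, a, l)) + (\<Sum>l<n. g (j, a, l))" for g :: "nat \<times> 'b \<times> nat \<Rightarrow> real"
  proof -
    have "?I = (\<lambda>l. (i, a, l)) ` {..<n} \<union> (\<lambda>l. (j, a, l)) ` {..<n}" by auto
    also have "sum g \<dots> = sum g ((\<lambda>l. (i, a, l)) ` {..<n}) + sum g ((\<lambda>l. (j, a, l)) ` {..<n})"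
      using ij by (intro sum.union_disjoint) auto
    also have "\<dots> = (\<Sum>l<n. g (i, a, l)) + (\<Sum>l<n. g (j, a, l))"
      by (simp add: sum.reindex inj_on_def)
    finally show ?thesis .
  qed
  have width: "(\<Sum>d\<in>?I. (1 - - 1)\<^sup>2 :: real) = 8 * real n"
    by (subst sum_I) simp
  have mean: "(\<Sum>d\<in>?I. expectation (?V d)) =
      real n * (\<Sum>k\<in>{1..K}. s k * (measure (Q i) {k} - measure (Q j) {k}))"
    using ij by (subst sum_I) (simp add: expect right_diff_distrib sum_subtractf)
  have emp: "(\<Sum>d\<in>?I. ?V d \<omega>) =
      real n * (\<Sum>k\<in>{1..K}. s k * (measure (F i \<omega>) {k} - measure (F j \<omega>) {k}))"
    if "\<omega> \<in> space M" for \<omega>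
  proof -
    have "(\<Sum>k\<in>{1..K}. s k * measure (F c \<omega>) {k}) = (\<Sum>l<n. s (X c a l \<omega>)) / real n" if "c \<in> {i, j}" for c
      unfolding F_def using measurable_space[OF rv[OF that] \<open>\<omega> \<in> space M\<close>]
      by (intro sum_empirical_law) auto
    then show ?thesis
      using ij n by (subst sum_I) (simp add: right_diff_distrib sum_subtractf sum_negf)
  qed
  have "{\<omega> \<in> space M. \<epsilon> \<le> (\<Sum>k\<in>{1..K}. s k *
      ((measure (F i \<omega>) {k} - measure (F j \<omega>) {k}) - (measure (Q i) {k} - measure (Q j) {k})))}
    = {\<omega> \<in> space M. (\<Sum>d\<in>?I. expectation (?V d)) + real n * \<epsilon> \<le> (\<Sum>d\<in>?I. ?V d \<omega>)}"
    (is "?L = ?R")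
  proof (intro Collect_cong conj_cong refl)
    fix \<omega> assume \<omega>: "\<omega> \<in> space M"
    let ?e = "\<Sum>k\<in>{1..K}. s k * (measure (F i \<omega>) {k} - measure (F j \<omega>) {k})"
    let ?q = "\<Sum>k\<in>{1..K}. s k * (measure (Q i) {k} - measure (Q j) {k})"
    have "(\<Sum>k\<in>{1..K}. s k *
      ((measure (F i \<omega>) {k} - measure (F j \<omega>) {k}) - (measure (Q i) {k} - measure (Q j) {k}))) = ?e - ?q"
      by (simp only: right_diff_distrib sum_subtractf)
    moreover have "\<epsilon> \<le> ?e - ?q \<longleftrightarrow> real n * (?q + \<epsilon>) \<le> real n * ?e"
      using n by (subst mult_le_cancel_left_pos) auto
    ultimately show "\<epsilon> \<le> (\<Sum>k\<in>{1..K}. s k *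
      ((measure (F i \<omega>) {k} - measure (F j \<omega>) {k}) - (measure (Q i) {k} - measure (Q j) {k})))
      \<longleftrightarrow> (\<Sum>d\<in>?I. expectation (?V d)) + real n * \<epsilon> \<le> (\<Sum>d\<in>?I. ?V d \<omega>)"
      unfolding mean emp[OF \<omega>] by (simp only: distrib_left)
  qed
  then have "prob ?L = prob ?R" by (rule arg_cong)
  also have "\<dots> \<le> exp (- 2 * (real n * \<epsilon>)\<^sup>2 / (\<Sum>d\<in>?I. (1 - - 1)\<^sup>2))"
    by (rule H.Hoeffding_ineq_ge) (use n \<epsilon> width in auto)
  also have "\<dots> = exp (- real n * \<epsilon>\<^sup>2 / 4)"
    unfolding width using n by (simp add: power2_eq_square)
  finally show ?thesis .
qed

text \<open>Bounding the difference of two empirical laws as one sum of \<open>2 * n\<close> independent terms, rather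
  than each law separately, gives the constant 16 in the sample size.\<close>

lemma (in prob_space) paired_deviation_bound:
  fixes X :: "nat \<Rightarrow> 'b \<Rightarrow> nat \<Rightarrow> 'a \<Rightarrow> nat" and \<epsilon> :: real
  assumes ij: "i \<noteq> j" and n: "0 < n" and \<epsilon>: "0 \<le> \<epsilon>"
    and indep: "indep_vars (\<lambda>_. count_space {1..K}) (\<lambda>(i, a, l). X i a l) ({i, j} \<times> {a} \<times> {..<n})"
    and laws: "\<And>c l. c \<in> {i, j} \<Longrightarrow> l < n \<Longrightarrow> distr M (count_space {1..K}) (X c a l) = Q c"
  defines "F \<equiv> \<lambda>c \<omega>. empirical_law K n (\<lambda>l. X c a l \<omega>)"
  defines "D \<equiv> {\<omega> \<in> space M. \<epsilon> \<le> (\<Sum>k\<in>{1..K}.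
      \<bar>(measure (F i \<omega>) {k} - measure (F j \<omega>) {k}) - (measure (Q i) {k} - measure (Q j) {k})\<bar>)}"
  shows "D \<in> events" "prob D \<le> 2 ^ K * exp (- real n * \<epsilon>\<^sup>2 / 4)"
proof -
  let ?x = "\<lambda>\<omega> k. (measure (F i \<omega>) {k} - measure (F j \<omega>) {k}) - (measure (Q i) {k} - measure (Q j) {k})"
  \<comment> \<open>A sign pattern is encoded by the subset of \<open>{1..K}\<close> that carries
    +1, so there are \<open>2 ^ K\<close> of them; the pattern of the deviation itself turns the
    signed sum into the sum of absolute values.\<close>
  let ?s = "\<lambda>B k. if k \<in> B then 1 else - 1 :: real"
  let ?G = "\<lambda>B. {\<omega> \<in> space M. \<epsilon> \<le> (\<Sum>k\<in>{1..K}. ?s B k * ?x \<omega> k)}"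
  have rv: "X c a l \<in> M \<rightarrow>\<^sub>M count_space {1..K}" if "c \<in> {i, j}" "l < n" for c l
    using indep that unfolding indep_vars_def by auto
  have F[measurable]: "(\<lambda>\<omega>. measure (F c \<omega>) {k}) \<in> borel_measurable M"
    if "c \<in> {i, j}" "k \<in> {1..K}" for c k
    unfolding F_def using rv that by (intro borel_measurable_empirical_law) auto
  have x: "(\<lambda>\<omega>. ?x \<omega> k) \<in> borel_measurable M" if "k \<in> {1..K}" for k
    using F[OF _ that] by (intro borel_measurable_diff borel_measurable_const) auto
  show "D \<in> events"
    unfolding D_def using x
    by (intro borel_measurable_le borel_measurable_const borel_measurable_sum borel_measurable_abs) auto
  have G: "?G B \<in> events" for B
    using x
    by (intro borel_measurable_le borel_measurable_const borel_measurable_sum borel_measurable_times) auto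
  have "D \<subseteq> (\<Union>B\<in>Pow {1..K}. ?G B)"
  proof
    fix \<omega> assume \<omega>: "\<omega> \<in> D"
    have "(\<Sum>k\<in>{1..K}. ?s {k \<in> {1..K}. 0 \<le> ?x \<omega> k} k * ?x \<omega> k) = (\<Sum>k\<in>{1..K}. \<bar>?x \<omega> k\<bar>)"
      by (intro sum.cong refl) auto
    with \<omega> have "\<omega> \<in> ?G {k \<in> {1..K}. 0 \<le> ?x \<omega> k}" by (simp add: D_def)
    moreover have "{k \<in> {1..K}. 0 \<le> ?x \<omega> k} \<in> Pow {1..K}" by auto
    ultimately show "\<omega> \<in> (\<Union>B\<in>Pow {1..K}. ?G B)" by (rule UN_I[rotated])
  qed
  then have "prob D \<le> prob (\<Union>B\<in>Pow {1..K}. ?G B)"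
    using G by (intro finite_measure_mono) auto
  also have "\<dots> \<le> (\<Sum>B\<in>Pow {1..K}. prob (?G B))"
    using G by (intro finite_measure_subadditive_finite) auto
  also have "\<dots> \<le> (\<Sum>B\<in>Pow {1..K}. exp (- real n * \<epsilon>\<^sup>2 / 4))"
    unfolding F_def by (intro sum_mono signed_deviation_bound assms) auto
  also have "\<dots> = 2 ^ K * exp (- real n * \<epsilon>\<^sup>2 / 4)"
    by (simp add: card_Pow)
  finally show "prob D \<le> 2 ^ K * exp (- real n * \<epsilon>\<^sup>2 / 4)" .
qed

text \<open>Deviations of different pairs share samples and are dependent, which a union bound
  tolerates: independence is used only among the draws of one pair at one evaluation. A single
  exceptional event \<open>Z\<close> is delivered because the cover sets need all deviations small
  at once.\<close>

lemma (in prob_space) uniform_deviation_bound: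
  fixes X :: "nat \<Rightarrow> 'b \<Rightarrow> nat \<Rightarrow> 'a \<Rightarrow> nat" and \<epsilon> :: real
  assumes D: "finite D" and n: "0 < n" and \<epsilon>: "0 \<le> \<epsilon>"
    and indep: "indep_vars (\<lambda>_. count_space {1..K}) (\<lambda>(i, a, l). X i a l) ({1..m} \<times> D \<times> {..<n})"
    and laws: "\<And>i a l. i \<in> {1..m} \<Longrightarrow> a \<in> D \<Longrightarrow> l < n \<Longrightarrow>
      distr M (count_space {1..K}) (X i a l) = Q i a"
  defines "F \<equiv> \<lambda>i a \<omega>. empirical_law K n (\<lambda>l. X i a l \<omega>)"
  obtains Z where "Z \<in> events"
    "prob Z \<le> real (card (pairs m)) * real (card D) * 2 ^ K * exp (- real n * \<epsilon>\<^sup>2 / 4)"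
    "\<And>\<omega> i j a. \<omega> \<in> space M - Z \<Longrightarrow> (i, j) \<in> pairs m \<Longrightarrow> a \<in> D \<Longrightarrow>
      (\<Sum>k\<in>{1..K}. \<bar>(measure (F i a \<omega>) {k} - measure (F j a \<omega>) {k}) -
        (measure (Q i a) {k} - measure (Q j a) {k})\<bar>) < \<epsilon>"
proof -
  define G where "G = (\<lambda>((i, j), a). {\<omega> \<in> space M. \<epsilon> \<le>
      (\<Sum>k\<in>{1..K}. \<bar>(measure (F i a \<omega>) {k} - measure (F j a \<omega>) {k}) -
        (measure (Q i a) {k} - measure (Q j a) {k})\<bar>)})"
  let ?c = "2 ^ K * exp (- real n * \<epsilon>\<^sup>2 / 4)"
  have G: "G x \<in> events" "prob (G x) \<le> ?c" if "x \<in> pairs m \<times> D" for x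
  proof -
    obtain i j a where "x = ((i, j), a)" by (metis surj_pair)
    with that have x: "x = ((i, j), a)" "i \<noteq> j" "i \<in> {1..m}" "j \<in> {1..m}" "a \<in> D"
      by (auto simp: pairs_def)
    have "indep_vars (\<lambda>_. count_space {1..K}) (\<lambda>(i, a, l). X i a l) ({i, j} \<times> {a} \<times> {..<n})"
      using indep by (rule indep_vars_subset) (use x in auto)
    moreover have "\<And>c l. c \<in> {i, j} \<Longrightarrow> l < n \<Longrightarrow> distr M (count_space {1..K}) (X c a l) = Q c a"
      using x laws by auto
    note bound = paired_deviation_bound[OF x(2) n \<epsilon> calculation this]
    show "G x \<in> events" "prob (G x) \<le> ?c"
      using bound unfolding x(1) G_def F_def by simp_all
  qed
  have fin: "finite (pairs m \<times> D)"
    using D finite_pairs by simp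
  show thesis
  proof (rule that[of "\<Union>x\<in>pairs m \<times> D. G x"])
    show "(\<Union>x\<in>pairs m \<times> D. G x) \<in> events"
      using G(1) fin by (intro sets.finite_UN) auto
    have "prob (\<Union>x\<in>pairs m \<times> D. G x) \<le> (\<Sum>x\<in>pairs m \<times> D. prob (G x))"
      using G(1) fin by (intro finite_measure_subadditive_finite) auto
    also have "\<dots> \<le> (\<Sum>x\<in>pairs m \<times> D. ?c)"
      by (intro sum_mono G)
    finally show "prob (\<Union>x\<in>pairs m \<times> D. G x) \<le>
        real (card (pairs m)) * real (card D) * 2 ^ K * exp (- real n * \<epsilon>\<^sup>2 / 4)"
      by (simp add: card_cartesian_product mult.assoc)
  next
    fix \<omega> i j a assume \<omega>: "\<omega> \<in> space M - (\<Union>x\<in>pairs m \<times> D. G x)" and "(i, j) \<in> pairs m" "a \<in> D"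
    then have "((i, j), a) \<in> pairs m \<times> D" by blast
    with \<omega> have "\<omega> \<notin> G ((i, j), a)" "\<omega> \<in> space M" by blast+
    then show "(\<Sum>k\<in>{1..K}. \<bar>(measure (F i a \<omega>) {k} - measure (F j a \<omega>) {k}) -
        (measure (Q i a) {k} - measure (Q j a) {k})\<bar>) < \<epsilon>"
      unfolding G_def by (simp add: not_le)
  qed
qed

text \<open>At deviation \<open>g / 2\<close> the exponent is n * g^2 / 16, which is at least
  \<Lambda> by the choice of \<open>n\<close>, and exp (- \<Lambda>) cancels the counts
  \<open>2 ^ K\<close>, \<open>m\<close> and \<open>A0\<close>, leaving \<beta> / 2.\<close>

lemma calibration_sample_size:
  fixes m A0 K n :: nat and \<Lambda> g \<beta> :: real
  assumes pos: "1 \<le> m" "1 \<le> A0" and \<beta>: "0 < \<beta>" "\<beta> < 1" and g: "0 < g"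
    and \<Lambda>: "\<Lambda> = real K * ln 2 + ln (2 * real m * real A0 / \<beta>)"
    and n: "n = nat \<lceil>16 * \<Lambda> / g\<^sup>2\<rceil>"
  shows "0 < n" "real m * real A0 * 2 ^ K * exp (- real n * (g / 2)\<^sup>2 / 4) \<le> \<beta>"
proof -
  have mA: "1 \<le> real m * real A0"
    using mult_mono[of 1 "real m" 1 "real A0"] pos by simp
  then have q: "1 < 2 * real m * real A0 / \<beta>"
    using \<beta> by (simp add: field_simps)
  then have "0 < ln (2 * real m * real A0 / \<beta>)" by simp
  moreover have "0 \<le> real K * ln 2" by simp
  ultimately have "0 < \<Lambda>" unfolding \<Lambda> by linarith
  then have "0 < 16 * \<Lambda> / g\<^sup>2" using g by simp
  then show "0 < n" unfolding n by simp
  have "16 * \<Lambda> / g\<^sup>2 \<le> real n" unfolding n by (rule real_nat_ceiling_ge)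
  then have "\<Lambda> \<le> real n * (g / 2)\<^sup>2 / 4"
    using g by (simp add: field_simps power2_eq_square)
  then have "exp (- real n * (g / 2)\<^sup>2 / 4) \<le> exp (- \<Lambda>)" by simp
  also have "\<dots> = 1 / (2 ^ K * (2 * real m * real A0 / \<beta>))"
  proof -
    have "exp (real K * ln 2) = (2 :: real) ^ K" by (simp add: exp_of_nat_mult)
    then have "exp \<Lambda> = 2 ^ K * (2 * real m * real A0 / \<beta>)"
      unfolding \<Lambda> exp_add using q by (simp only: exp_ln less_trans[OF zero_less_one])
    then show ?thesis by (simp only: exp_minus inverse_eq_divide)
  qed
  finally have "real m * real A0 * 2 ^ K * exp (- real n * (g / 2)\<^sup>2 / 4) \<le>
      real m * real A0 * 2 ^ K * (1 / (2 ^ K * (2 * real m * real A0 / \<beta>)))"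
    by (intro mult_left_mono) auto
  also have "\<dots> = \<beta> / 2" using pos \<beta> by (simp add: field_simps)
  also have "\<dots> \<le> \<beta>" using \<beta> by simp
  finally show "real m * real A0 * 2 ^ K * exp (- real n * (g / 2)\<^sup>2 / 4) \<le> \<beta>" .
qed

section \<open>From deviations to cover sets\<close>

lemma l1_dist_deviation:
  "\<bar>l1_dist K p q - l1_dist K p' q'\<bar> \<le> (\<Sum>k\<in>{1..K}.
     \<bar>(measure p {k} - measure q {k}) - (measure p' {k} - measure q' {k})\<bar>)"
proof -
  \<comment> \<open>The reverse triangle inequality is applied at each point to the differences of
    the two laws as a whole, the quantity that the paired deviation bound controls.\<close>
  have "\<bar>l1_dist K p q - l1_dist K p' q'\<bar> \<le>
      (\<Sum>k\<in>{1..K}. \<bar>\<bar>measure p {k} - measure q {k}\<bar> - \<bar>measure p' {k} - measure q' {k}\<bar>\<bar>)"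
    unfolding l1_dist_def sum_subtractf[symmetric] by (rule sum_abs)
  also have "\<dots> \<le> (\<Sum>k\<in>{1..K}.
     \<bar>(measure p {k} - measure q {k}) - (measure p' {k} - measure q' {k})\<bar>)"
    by (intro sum_mono abs_triangle_ineq3)
  finally show ?thesis .
qed

text \<open>An evaluation of \<open>u\<close> that reaches \<eta> under \<open>Q\<close> reaches
  \<eta>' under \<open>Q'\<close>, and one witness suffices for a maximum. The deviation is
  one-sided, so both inclusions follow with the true and the empirical laws exchanging
  places.\<close>

lemma cover_sets_mono_deviation:
  assumes \<A>: "finite (\<A> u)" "\<A> u \<noteq> {}"
    and dev: "\<And>i j a. (i, j) \<in> pairs M \<Longrightarrow> a \<in> \<A> u \<Longrightarrow>
      l1_dist K (Q i a) (Q j a) - l1_dist K (Q' i a) (Q' j a) \<le> \<eta> - \<eta>'"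
  shows "cover_sets M K Q \<A> \<eta> u \<subseteq> cover_sets M K Q' \<A> \<eta>' u"
proof
  fix ij assume ij: "ij \<in> cover_sets M K Q \<A> \<eta> u"
  obtain i j where [simp]: "ij = (i, j)" by fastforce
  from ij obtain a where "(i, j) \<in> pairs M" "a \<in> \<A> u" "\<eta> \<le> l1_dist K (Q i a) (Q j a)"
    by (auto simp: cover_sets_def module_sep_ge_iff[of \<A> u, OF \<A>])
  with dev[of i j a] have "\<exists>a\<in>\<A> u. \<eta>' \<le> l1_dist K (Q' i a) (Q' j a)"
    by (intro bexI[of _ a]) auto
  with \<open>(i, j) \<in> pairs M\<close> show "ij \<in> cover_sets M K Q' \<A> \<eta>' u"
    by (simp add: cover_sets_def module_sep_ge_iff[of \<A> u, OF \<A>])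
qed

lemma borel_measurable_module_sep:
  assumes \<A>: "finite (\<A> u)" and ij: "(i, j) \<in> pairs M"
    and X: "\<And>i a l. i \<in> {1..M} \<Longrightarrow> a \<in> \<A> u \<Longrightarrow> l < n \<Longrightarrow> X i a l \<in> \<Omega> \<rightarrow>\<^sub>M count_space {1..K}"
  shows "(\<lambda>\<omega>. module_sep K (\<lambda>i a. empirical_law K n (\<lambda>l. X i a l \<omega>)) \<A> u (i, j)) \<in> borel_measurable \<Omega>"
proof -
  have F: "(\<lambda>\<omega>. measure (empirical_law K n (\<lambda>l. X c a l \<omega>)) {k}) \<in> borel_measurable \<Omega>"
    if "c \<in> {i, j}" "a \<in> \<A> u" "k \<in> {1..K}" for c a k
    using that ij by (intro borel_measurable_empirical_law X) (auto simp: pairs_def)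
  show ?thesis
    unfolding module_sep_def l1_dist_def prod.case
    by (intro borel_measurable_Max[OF \<A>] borel_measurable_sum borel_measurable_abs
        borel_measurable_diff F) auto
qed

text \<open>Enlarging the cover sets within \<open>pairs M\<close> turns each separating design into
  a cover, so the instance is feasible and its optimum costs no more than any separating design.
  This carries the guarantee of the solver over to the true optimum.\<close>

lemma solver_on_sandwiched_cover:
  assumes M: "2 \<le> M" and U: "finite U" and \<kappa>: "\<forall>u\<in>U. 0 < \<kappa> u"
    and \<alpha>: "1 \<le> \<alpha>" and solver: "cover_solver \<alpha> solver" and \<eta>: "0 < \<eta>"
    and sub: "\<And>u. u \<in> U \<Longrightarrow> cover_sets M K Q \<A> \<eta> u \<subseteq> C u" "\<And>u. u \<in> U \<Longrightarrow> C u \<subseteq> pairs M"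
    and ex: "\<exists>S\<subseteq>U. separating M K Q \<A> \<eta> S"
  shows "\<exists>Shat. returned_cover solver U C \<kappa> (pairs M) Shat \<and>
    (\<forall>Sstar. is_arg_min (sum \<kappa>) (\<lambda>S. S \<subseteq> U \<and> separating M K Q \<A> \<eta> S) Sstar \<longrightarrow>
       sum \<kappa> Shat \<le> \<alpha> * sum \<kappa> Sstar)"
proof -
  have cover: "is_cover U C (pairs M) S" if "S \<subseteq> U" "separating M K Q \<A> \<eta> S" for S
  proof -
    have "(\<Union>u\<in>S. cover_sets M K Q \<A> \<eta> u) = pairs M"
      using that separating_iff_cover[OF M finite_subset[OF _ U] \<eta>] by blast
    moreover have "(\<Union>u\<in>S. cover_sets M K Q \<A> \<eta> u) \<subseteq> (\<Union>u\<in>S. C u)" "(\<Union>u\<in>S. C u) \<subseteq> pairs M"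
      using sub that(1) by blast+
    ultimately show ?thesis using that(1) by (auto simp: is_cover_def)
  qed
  let ?S = "solver U C \<kappa> (pairs M)"
  from ex obtain S where "is_cover U C (pairs M) S" using cover by blast
  then have sol: "is_cover U C (pairs M) ?S"
    "sum \<kappa> ?S \<le> \<alpha> * Min (sum \<kappa> ` {S. is_cover U C (pairs M) S})"
    using solver U \<kappa> sub(2) finite_pairs[of M] unfolding cover_solver_def by blast+
  have fin: "finite {S. is_cover U C (pairs M) S}"
    using U by (rule finite_subset[rotated, OF finite_Pow_iff[THEN iffD2]]) (auto simp: is_cover_def)
  have "sum \<kappa> ?S \<le> \<alpha> * sum \<kappa> Sstar"
    if "is_arg_min (sum \<kappa>) (\<lambda>S. S \<subseteq> U \<and> separating M K Q \<A> \<eta> S) Sstar" for Sstar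
  proof -
    have "is_cover U C (pairs M) Sstar"
      using that cover by (auto simp: is_arg_min_def)
    then have "Min (sum \<kappa> ` {S. is_cover U C (pairs M) S}) \<le> sum \<kappa> Sstar"
      using fin by (intro Min_le) auto
    then have "\<alpha> * Min (sum \<kappa> ` {S. is_cover U C (pairs M) S}) \<le> \<alpha> * sum \<kappa> Sstar"
      using \<alpha> by (intro mult_left_mono) auto
    with sol(2) show ?thesis by linarith
  qed
  with sol(1) show ?thesis
    unfolding returned_cover_def by blast
qed

section \<open>Calibration and inner value combined\<close>

theorem theorem4p2:
  fixes M K n m A0 :: nat
    and A :: "'a measure" and Y :: "'y measure" and P :: "nat \<Rightarrow> 'a \<Rightarrow> 'y measure"
    and b0 :: "nat \<Rightarrow> real"
    and U :: "'u set" and \<kappa> :: "'u \<Rightarrow> real" and \<A> :: "'u \<Rightarrow> 'a set"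
    and \<phi> :: "'a \<Rightarrow> 'y \<Rightarrow> nat"
    and \<eta>_minus \<eta>_plus g \<beta> \<delta> \<alpha> \<Lambda> :: real
    and solver :: "('u, nat \<times> nat) solver"
    and \<Omega> :: "'w measure" and X :: "nat \<Rightarrow> 'a \<Rightarrow> nat \<Rightarrow> 'w \<Rightarrow> nat"
    and Q :: "nat \<Rightarrow> 'a \<Rightarrow> nat measure"
    and Chat :: "'w \<Rightarrow> 'u \<Rightarrow> (nat \<times> nat) set"
    and E :: "'w set" and draws :: "(nat \<times> 'a \<times> nat) set"
  (* model *)
  assumes M: "M \<ge> 2"
    and kernels: "\<forall>i\<in>{1..M}. P i \<in> A \<rightarrow>\<^sub>M prob_algebra Y"
    and densities: "jointly_measurable_densities M A Y P"
    and prior: "\<forall>i\<in>{1..M}. 0 < b0 i" "(\<Sum>i\<in>{1..M}. b0 i) = 1"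
  (* modules and summaries *)
    and modules: "finite U" "U \<noteq> {}" "\<forall>u\<in>U. 0 < \<kappa> u"
      "\<forall>u\<in>U. finite (\<A> u) \<and> \<A> u \<noteq> {} \<and> \<A> u \<in> sets A"
    and A0: "A0 = card (\<Union>u\<in>U. \<A> u)"
    and K: "K \<ge> 1"
    and summaries: "\<forall>a\<in>space A. \<phi> a \<in> Y \<rightarrow>\<^sub>M count_space {1..K}"
    and Q: "Q = summary_law K P \<phi>"
    and m: "m = card (pairs M)"
  (* parameters *)
    and \<eta>: "0 < \<eta>_minus" "\<eta>_minus < \<eta>_plus" "\<eta>_plus \<le> 2"
    and g: "g = \<eta>_plus - \<eta>_minus"
    and \<beta>: "0 < \<beta>" "\<beta> < 1"
    and \<delta>: "0 < \<delta>" "\<delta> < 1"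
    and \<alpha>: "1 \<le> \<alpha>" and solver: "cover_solver \<alpha> solver"
    and \<Lambda>: "\<Lambda> = real K * ln 2 + ln (2 * real m * real A0 / \<beta>)"
    and n: "n = nat \<lceil>16 * \<Lambda> / g\<^sup>2\<rceil>"
  (* calibration: X i a l is draw number l for the pair (i, a) *)
    and \<Omega>: "prob_space \<Omega>"
    and draws: "draws = {1..M} \<times> (\<Union>u\<in>U. \<A> u) \<times> {..<n}"
    and indep: "prob_space.indep_vars \<Omega> (\<lambda>_. count_space {1..K}) (\<lambda>(i, a, l). X i a l) draws"
    and laws: "\<forall>(i, a, l)\<in>draws. distr \<Omega> (count_space {1..K}) (X i a l) = Q i a"
    and Chat: "Chat = (\<lambda>\<omega>. cover_sets M K (\<lambda>i a. empirical_law K n (\<lambda>l. X i a l \<omega>)) \<A>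
                              ((\<eta>_minus + \<eta>_plus) / 2))"
    and E: "E = {\<omega> \<in> space \<Omega>. \<forall>u\<in>U. cover_sets M K Q \<A> \<eta>_plus u \<subseteq> Chat \<omega> u \<and>
                                     Chat \<omega> u \<subseteq> cover_sets M K Q \<A> \<eta>_minus u}"
  shows "E \<in> sets \<Omega> \<and> measure \<Omega> E \<ge> 1 - \<beta> \<and>
    (\<forall>\<omega>\<in>E.
      (\<forall>S. S \<subseteq> U \<and> (\<Union>u\<in>S. Chat \<omega> u) = pairs M \<longrightarrow> separating M K Q \<A> \<eta>_minus S) \<and>
      ((\<exists>S\<subseteq>U. separating M K Q \<A> \<eta>_plus S) \<longrightarrow>
        (\<exists>Shat. returned_cover solver U (Chat \<omega>) \<kappa> (pairs M) Shat \<and>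
          (\<forall>Sstar. is_arg_min (sum \<kappa>) (\<lambda>S. S \<subseteq> U \<and> separating M K Q \<A> \<eta>_plus S) Sstar \<longrightarrow>
             sum \<kappa> Shat \<le> \<alpha> * sum \<kappa> Sstar))) \<and>
      ((\<nexists>S. S \<subseteq> U \<and> (\<Union>u\<in>S. Chat \<omega> u) = pairs M) \<longrightarrow>
        (\<nexists>S. S \<subseteq> U \<and> separating M K Q \<A> \<eta>_plus S)) \<and>
      (\<forall>Shat. returned_cover solver U (Chat \<omega>) \<kappa> (pairs M) Shat \<longrightarrow>
        inner_value \<delta> M b0 A Y P (\<Union>u\<in>Shat. \<A> u)
          \<le> ennreal ((real M - 1) * real_of_int \<lceil>8 / \<eta>_minus\<^sup>2 * ln ((real M - 1) / \<delta>)\<rceil>))) \<and>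
    card draws = n * M * A0"
proof -
  interpret prob_space \<Omega> by fact
  let ?D = "\<Union>u\<in>U. \<A> u"
  define F where "F \<omega> i a = empirical_law K n (\<lambda>l. X i a l \<omega>)" for \<omega> i a
  have Chat_F: "Chat \<omega> = cover_sets M K (F \<omega>) \<A> ((\<eta>_minus + \<eta>_plus) / 2)" for \<omega>
    unfolding Chat F_def ..
  have D: "finite ?D" "?D \<noteq> {}"
    using modules by auto
  have "1 \<le> m" "1 \<le> A0"
    unfolding m A0 using D finite_pairs pairs_nonempty[OF M] by (simp_all add: Suc_le_eq card_gt_0_iff)
  moreover have g_pos: "0 < g" using g \<eta> by simp
  ultimately have sample: "0 < n" "real m * real A0 * 2 ^ K * exp (- real n * (g / 2)\<^sup>2 / 4) \<le> \<beta>"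
    using calibration_sample_size[OF _ _ \<beta> _ \<Lambda> n] by blast+
  have rv: "X i a l \<in> \<Omega> \<rightarrow>\<^sub>M count_space {1..K}" if "i \<in> {1..M}" "a \<in> ?D" "l < n" for i a l
  proof -
    have "(i, a, l) \<in> draws" using that by (simp add: draws)
    then show ?thesis using indep unfolding indep_vars_def by force
  qed
  have E_sets: "E \<in> sets \<Omega>"
  proof -
    let ?sep = "\<lambda>\<omega> u ij. (\<eta>_minus + \<eta>_plus) / 2 \<le> module_sep K (F \<omega>) \<A> u ij"
    let ?C = "\<lambda>\<eta> u. cover_sets M K Q \<A> \<eta> u"
    \<comment> \<open>Membership in the true cover sets does not depend on \<omega>, so
      \<open>E\<close> is a finite Boolean combination of threshold events of the empirical
      separations.\<close>
    have "E = {\<omega> \<in> space \<Omega>. \<forall>u\<in>U. \<forall>ij\<in>pairs M.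
        (ij \<in> ?C \<eta>_plus u \<longrightarrow> ?sep \<omega> u ij) \<and> (?sep \<omega> u ij \<longrightarrow> ij \<in> ?C \<eta>_minus u)}"
      unfolding E Chat_F by (rule Collect_cong) (auto simp: cover_sets_def)
    also have "\<dots> \<in> sets \<Omega>"
    proof (intro sets.sets_Collect_finite_All' sets.sets_Collect_conj sets.sets_Collect_imp
        sets.sets_Collect_const modules(1) finite_pairs)
      fix u ij assume u: "u \<in> U" and ij: "ij \<in> pairs M"
      obtain i j where "ij = (i, j)" by fastforce
      then have "(\<lambda>\<omega>. module_sep K (F \<omega>) \<A> u ij) \<in> borel_measurable \<Omega>"
        unfolding F_def using u ij modules(4)
        by (auto intro!: borel_measurable_module_sep[where M=M] rv)
      then show "{\<omega> \<in> space \<Omega>. ?sep \<omega> u ij} \<in> sets \<Omega>" "{\<omega> \<in> space \<Omega>. ?sep \<omega> u ij} \<in> sets \<Omega>"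
        by measurable
    qed (use modules(2) pairs_nonempty[OF M] in auto)
    finally show ?thesis .
  qed
  have E_prob: "1 - \<beta> \<le> measure \<Omega> E"
  proof -
    have laws': "distr \<Omega> (count_space {1..K}) (X i a l) = Q i a"
      if "i \<in> {1..M}" "a \<in> ?D" "l < n" for i a l
      using laws that by (auto simp: draws)
    obtain Z where Z: "Z \<in> events"
      "prob Z \<le> real m * real A0 * 2 ^ K * exp (- real n * (g / 2)\<^sup>2 / 4)"
      "\<And>\<omega> i j a. \<omega> \<in> space \<Omega> - Z \<Longrightarrow> (i, j) \<in> pairs M \<Longrightarrow> a \<in> ?D \<Longrightarrow>
        (\<Sum>k\<in>{1..K}. \<bar>(measure (F \<omega> i a) {k} - measure (F \<omega> j a) {k}) -
          (measure (Q i a) {k} - measure (Q j a) {k})\<bar>) < g / 2"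
      using uniform_deviation_bound[OF D(1) sample(1) _ indep[unfolded draws] laws', of "g / 2"] g_pos
      unfolding F_def m A0 by auto
    have "space \<Omega> - Z \<subseteq> E"
    proof
      fix \<omega> assume \<omega>: "\<omega> \<in> space \<Omega> - Z"
      have dev: "\<bar>l1_dist K (F \<omega> i a) (F \<omega> j a) - l1_dist K (Q i a) (Q j a)\<bar> < g / 2"
        if "(i, j) \<in> pairs M" "a \<in> ?D" for i j a
        using l1_dist_deviation Z(3)[OF \<omega> that] by (rule le_less_trans)
      have "cover_sets M K Q \<A> \<eta>_plus u \<subseteq> Chat \<omega> u \<and> Chat \<omega> u \<subseteq> cover_sets M K Q \<A> \<eta>_minus u"
        if u: "u \<in> U" for u
      proof -
        \<comment> \<open>Both thresholds lie \<open>g / 2\<close> away from the midpoint, exactly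
          the deviation allowed off \<open>Z\<close>.\<close>
        have "l1_dist K (Q i a) (Q j a) - l1_dist K (F \<omega> i a) (F \<omega> j a) \<le> \<eta>_plus - (\<eta>_minus + \<eta>_plus) / 2"
          "l1_dist K (F \<omega> i a) (F \<omega> j a) - l1_dist K (Q i a) (Q j a) \<le> (\<eta>_minus + \<eta>_plus) / 2 - \<eta>_minus"
          if "(i, j) \<in> pairs M" "a \<in> \<A> u" for i j a
        proof -
          have "a \<in> ?D" using that(2) u by blast
          note d = dev[OF that(1) this, unfolded g abs_less_iff]
          show "l1_dist K (Q i a) (Q j a) - l1_dist K (F \<omega> i a) (F \<omega> j a) \<le> \<eta>_plus - (\<eta>_minus + \<eta>_plus) / 2"
            using d by (simp add: field_simps)
          show "l1_dist K (F \<omega> i a) (F \<omega> j a) - l1_dist K (Q i a) (Q j a) \<le> (\<eta>_minus + \<eta>_plus) / 2 - \<eta>_minus"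
            using d by (simp add: field_simps)
        qed
        then show ?thesis
          unfolding Chat_F using modules(4) u by (intro conjI cover_sets_mono_deviation) auto
      qed
      then show "\<omega> \<in> E" using \<omega> unfolding E by blast
    qed
    then have "prob (space \<Omega> - Z) \<le> prob E"
      using E_sets by (rule finite_measure_mono)
    then show ?thesis
      using prob_compl[OF Z(1)] Z(2) sample(2) by linarith
  qed
  have sandwich: "cover_sets M K Q \<A> \<eta>_plus u \<subseteq> Chat \<omega> u" "Chat \<omega> u \<subseteq> cover_sets M K Q \<A> \<eta>_minus u"
    if "\<omega> \<in> E" "u \<in> U" for \<omega> u
    using that unfolding E by blast+
  have Chat_pairs: "Chat \<omega> u \<subseteq> pairs M" for \<omega> u
    unfolding Chat_F cover_sets_def by blast
  have \<eta>_plus: "0 < \<eta>_plus" using \<eta> by simp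
  have item1: "separating M K Q \<A> \<eta>_minus S"
    if "\<omega> \<in> E" "S \<subseteq> U" "(\<Union>u\<in>S. Chat \<omega> u) = pairs M" for \<omega> S
  proof -
    have "(\<Union>u\<in>S. Chat \<omega> u) \<subseteq> (\<Union>u\<in>S. cover_sets M K Q \<A> \<eta>_minus u)"
      using sandwich(2)[OF that(1)] that(2) by blast
    moreover have "(\<Union>u\<in>S. cover_sets M K Q \<A> \<eta>_minus u) \<subseteq> pairs M"
      by (auto simp: cover_sets_def)
    ultimately show ?thesis
      unfolding separating_iff_cover[OF M finite_subset[OF that(2) modules(1)] \<eta>(1)] that(3)
      by (rule subset_antisym[rotated])
  qed
  have item2: "\<exists>Shat. returned_cover solver U (Chat \<omega>) \<kappa> (pairs M) Shat \<and>
      (\<forall>Sstar. is_arg_min (sum \<kappa>) (\<lambda>S. S \<subseteq> U \<and> separating M K Q \<A> \<eta>_plus S) Sstar \<longrightarrow>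
         sum \<kappa> Shat \<le> \<alpha> * sum \<kappa> Sstar)"
    if "\<omega> \<in> E" "\<exists>S\<subseteq>U. separating M K Q \<A> \<eta>_plus S" for \<omega>
    using M modules(1,3) \<alpha> solver \<eta>_plus sandwich(1)[OF that(1)] Chat_pairs that(2)
    by (rule solver_on_sandwiched_cover)
  \<comment> \<open>The output of the solver is itself the required cover.\<close>
  have item3: "\<exists>S. S \<subseteq> U \<and> (\<Union>u\<in>S. Chat \<omega> u) = pairs M"
    if "\<omega> \<in> E" "S \<subseteq> U" "separating M K Q \<A> \<eta>_plus S" for \<omega> S
    using item2[OF that(1)] that(2,3) unfolding returned_cover_def is_cover_def by blast
  have item4: "inner_value \<delta> M b0 A Y P (\<Union>u\<in>Shat. \<A> u)
      \<le> ennreal ((real M - 1) * real_of_int \<lceil>8 / \<eta>_minus\<^sup>2 * ln ((real M - 1) / \<delta>)\<rceil>)"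
    if "\<omega> \<in> E" "returned_cover solver U (Chat \<omega>) \<kappa> (pairs M) Shat" for \<omega> Shat
  proof -
    have S: "Shat \<subseteq> U" "(\<Union>u\<in>Shat. Chat \<omega> u) = pairs M"
      using that(2) by (auto simp: returned_cover_def is_cover_def)
    show ?thesis
    proof (rule inner_value_separating_le[OF M])
      show "separating M K (summary_law K P \<phi>) \<A> \<eta>_minus Shat"
        using item1[OF that(1) S] unfolding Q .
      show "finite Shat" using S(1) modules(1) by (rule finite_subset)
    qed (use kernels prior modules(4) S(1) summaries \<eta> \<delta> in \<open>auto intro: less_imp_le\<close>)
  qed
  show ?thesis
  proof (intro conjI ballI E_sets E_prob)
    show "card draws = n * M * A0"
      unfolding draws A0 by (simp add: card_cartesian_product mult.commute mult.left_commute)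
    fix \<omega> assume \<omega>: "\<omega> \<in> E"
    show "\<forall>S. S \<subseteq> U \<and> (\<Union>u\<in>S. Chat \<omega> u) = pairs M \<longrightarrow> separating M K Q \<A> \<eta>_minus S"
      by (intro allI impI, elim conjE, rule item1[OF \<omega>])
    show "(\<exists>S\<subseteq>U. separating M K Q \<A> \<eta>_plus S) \<longrightarrow>
        (\<exists>Shat. returned_cover solver U (Chat \<omega>) \<kappa> (pairs M) Shat \<and>
          (\<forall>Sstar. is_arg_min (sum \<kappa>) (\<lambda>S. S \<subseteq> U \<and> separating M K Q \<A> \<eta>_plus S) Sstar \<longrightarrow>
             sum \<kappa> Shat \<le> \<alpha> * sum \<kappa> Sstar))"
      by (rule impI, rule item2[OF \<omega>])
    show "(\<nexists>S. S \<subseteq> U \<and> (\<Union>u\<in>S. Chat \<omega> u) = pairs M) \<longrightarrow>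
        (\<nexists>S. S \<subseteq> U \<and> separating M K Q \<A> \<eta>_plus S)"
    proof (rule contrapos_nn[THEN impI])
      assume "\<exists>S. S \<subseteq> U \<and> separating M K Q \<A> \<eta>_plus S"
      then show "\<exists>S. S \<subseteq> U \<and> (\<Union>u\<in>S. Chat \<omega> u) = pairs M"
        by (elim exE conjE) (rule item3[OF \<omega>])
    qed
    show "\<forall>Shat. returned_cover solver U (Chat \<omega>) \<kappa> (pairs M) Shat \<longrightarrow>
        inner_value \<delta> M b0 A Y P (\<Union>u\<in>Shat. \<A> u)
          \<le> ennreal ((real M - 1) * real_of_int \<lceil>8 / \<eta>_minus\<^sup>2 * ln ((real M - 1) / \<delta>)\<rceil>)"
      by (intro allI impI, rule item4[OF \<omega>])
  qed
qed

end
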